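(* Let $V$ be a $\mathbb{K}$-vector space and let $f$ be a linear endomorphism of $V$. Define a bilinear product $\bullet$ on $T(V)$ by: for all $m,n\ge 0$ and $x_1,\ldots,x_m,y_1,\ldots,y_n\in V$, $$x_1\ldots x_m\bullet y_1\ldots y_n=\sum_{i=1}^m x_1\ldots x_{i-1}\,f(x_i)\,(x_{i+1}\ldots x_m\mathbin{\sqcup\!\sqcup} y_1\ldots y_n).$$ Then $(T(V),\mathbin{\sqcup\!\sqcup},\bullet,\Delta)$ is a Com-PreLie bialgebra, denoted by $T(V,f)$. Conversely, if $\bullet$ is a product on $T(V)$, homogeneous of some degree $N\ge 0$ (i.e. $V^{\otimes k}\bullet V^{\otimes l}\subseteq V^{\otimes (k+l+N)}$ for all $k,l\ge 0$), such that $(T(V),\mathbin{\sqcup\!\sqcup},\bullet,\Delta)$ is a Com-PreLie bialgebra, then there exists a unique linear map $f:V\longrightarrow V$ such that $(T(V),\mathbin{\sqcup\!\sqcup},\bullet,\Delta)=T(V,f)$.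
   Context: $\mathbb{K}$ is a field of characteristic zero. $T(V)=\bigoplus_{n\ge0}V^{\otimes n}$; elements are written as words, the empty word is $\emptyset$; juxtaposition is concatenation; $\mathbin{\sqcup\!\sqcup}$ is the shuffle product (with unit $\emptyset$), $\Delta(v_1\ldots v_n)=\sum_{i=0}^n v_1\ldots v_i\otimes v_{i+1}\ldots v_n$ is deconcatenation. A Com-PreLie algebra is a vector space $A$ with bilinear products $\cdot,\bullet$ such that $\cdot$ is associative and commutative, $(a\bullet b)\bullet c-a\bullet(b\bullet c)=(a\bullet c)\bullet b-a\bullet(c\bullet b)$ and $(a\cdot b)\bullet c=(a\bullet c)\cdot b+a\cdot(b\bullet c)$ for all $a,b,c$; it is unitary if $(A,\cdot)$ has a unit. A Com-PreLie bialgebra is $(A,\cdot,\bullet,\Delta)$ with $(A,\cdot,\bullet)$ a unitary Com-PreLie algebra, $(A,\cdot,\Delta)$ a bialgebra, and $\Delta(a\bullet b)=a^{(1)}\otimes a^{(2)}\bullet b+a^{(1)}\bullet b^{(1)}\otimes a^{(2)}\cdot b^{(2)}$ for all $a,b\in A$ (Sweedler notation). *)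

theory Defs
  imports Complex_Main "HOL-Library.Function_Algebras"
begin

section \<open>Tensor constructions\<close>

text \<open>
  A vector space is either a whole type with a scalar multiplication (\<^locale>\<open>vector_space\<close>)
  or a subspace of one.  Spaces of tensors are realised as spaces of functionals: a tensor
  monomial x is identified with evaluation at x on the forms of the appropriate kind
  (bilinear, trilinear, multilinear), and the tensor space is the span of the monomials.
  Over a field this is a model of the tensor product; its universal property is
  \<open>lift_exists\<close> together with \<open>lift_unique\<close> below.
\<close>

definition fscale :: "'k::field \<Rightarrow> ('x \<Rightarrow> 'k) \<Rightarrow> 'x \<Rightarrow> 'k" where
  "fscale c t = (\<lambda>x. c * t x)"

lemma fscale_apply: "fscale c t x = c * t x"
  by (simp add: fscale_def)

lemma vector_space_fscale: "vector_space (fscale :: 'k::field \<Rightarrow> ('x \<Rightarrow> 'k) \<Rightarrow> 'x \<Rightarrow> 'k)"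
  by unfold_locales (auto simp: fscale_def fun_eq_iff algebra_simps)

lemma module_fscale: "module (fscale :: 'k::field \<Rightarrow> ('x \<Rightarrow> 'k) \<Rightarrow> 'x \<Rightarrow> 'k)"
  using vector_space_fscale by (simp add: module_iff_vector_space)

lemma vector_space_mult: "vector_space ((*) :: 'k::field \<Rightarrow> 'k \<Rightarrow> 'k)"
  by unfold_locales (auto simp: algebra_simps)

definition eval_at :: "('x \<Rightarrow> 'k::field) set \<Rightarrow> 'x \<Rightarrow> ('x \<Rightarrow> 'k) \<Rightarrow> 'k" where
  "eval_at \<Phi> x = (\<lambda>\<phi>. if \<phi> \<in> \<Phi> then \<phi> x else 0)"

text \<open>The linear map sending each monomial \<open>e x\<close> (\<open>x \<in> X\<close>) to \<open>g x\<close>; it is only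
  determined on the span of \<open>e ` X\<close>, and only used there.\<close>

definition lift :: "('x \<Rightarrow> ('y \<Rightarrow> 'k::field)) \<Rightarrow> 'x set \<Rightarrow> ('k \<Rightarrow> 'c::ab_group_add \<Rightarrow> 'c)
    \<Rightarrow> ('x \<Rightarrow> 'c) \<Rightarrow> ('y \<Rightarrow> 'k) \<Rightarrow> 'c" where
  "lift e X s g =
     (SOME L. Vector_Spaces.linear fscale s L \<and> (\<forall>x\<in>X. L (e x) = g x))"

lemma separating_functional:
  assumes "vector_space (s :: 'k::field \<Rightarrow> 'c::ab_group_add \<Rightarrow> 'c)" "d \<noteq> 0"
  obtains l where "Vector_Spaces.linear s ((*) :: 'k \<Rightarrow> 'k \<Rightarrow> 'k) l" "l d = 1"
proof -
  interpret vector_space_pair s "(*) :: 'k \<Rightarrow> 'k \<Rightarrow> 'k"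
    using assms(1) vector_space_mult by (simp add: vector_space_pair_def)
  have "vs1.independent {d}" using assms(2) by simp
  from linear_independent_extend[OF this, of "\<lambda>_. 1"] that show ?thesis by auto
qed

lemma lift_exists:
  fixes s :: "'k::field \<Rightarrow> 'c::ab_group_add \<Rightarrow> 'c"
  assumes s: "vector_space s"
    and g: "\<And>l. Vector_Spaces.linear s (*) l \<Longrightarrow> (\<lambda>x. l (g x)) \<in> \<Phi>"
  shows "\<exists>L. Vector_Spaces.linear fscale s L \<and> (\<forall>x\<in>X. L (eval_at \<Phi> x) = g x)"
proof -
  interpret vector_space_pair "fscale :: 'k \<Rightarrow> (('b \<Rightarrow> 'k) \<Rightarrow> 'k) \<Rightarrow> _" s
    using s vector_space_fscale by (simp add: vector_space_pair_def)
  obtain B where B: "B \<subseteq> eval_at \<Phi> ` X" "vs1.independent B" "eval_at \<Phi> ` X \<subseteq> vs1.span B"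
    using vs1.maximal_independent_subset by metis
  define p where "p b = (SOME x. x \<in> X \<and> eval_at \<Phi> x = b)" for b
  have p: "p b \<in> X" "eval_at \<Phi> (p b) = b" if "b \<in> B" for b
    using someI_ex[of "\<lambda>x. x \<in> X \<and> eval_at \<Phi> x = b"] B(1) that
    unfolding p_def by blast+
  obtain L where L: "Vector_Spaces.linear fscale s L" "\<And>b. b \<in> B \<Longrightarrow> L b = g (p b)"
    using linear_independent_extend[OF B(2), of "\<lambda>b. g (p b)"] by auto
  have "L (eval_at \<Phi> x) = g x" if x: "x \<in> X" for x
  proof (rule ccontr)
    assume neq: "L (eval_at \<Phi> x) \<noteq> g x"
    obtain l where l: "Vector_Spaces.linear s ((*) :: 'k \<Rightarrow> 'k \<Rightarrow> 'k) l"
      "l (L (eval_at \<Phi> x) - g x) = 1"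
      using separating_functional[OF s, of "L (eval_at \<Phi> x) - g x"] neq by auto
    interpret l: Vector_Spaces.linear s "(*) :: 'k \<Rightarrow> 'k \<Rightarrow> 'k" l by (rule l)
    interpret L: Vector_Spaces.linear fscale s L by (rule L)
    have mem: "(\<lambda>x. l (g x)) \<in> \<Phi>" by (rule g[OF l(1)])
    have "t (\<lambda>x. l (g x)) = l (L t)" if "t \<in> vs1.span B" for t
      using that
    proof (induction rule: vs1.span_induct_alt)
      case base
      have "l (L 0) = 0" by (simp only: L.zero l.zero)
      thus ?case by (simp add: zero_fun_def)
    next
      case (step c b t)
      have "b (\<lambda>x. l (g x)) = eval_at \<Phi> (p b) (\<lambda>x. l (g x))" using p(2)[OF step(1)] by simp
      also have "\<dots> = l (g (p b))" using mem by (simp add: eval_at_def)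
      finally have "b (\<lambda>x. l (g x)) = l (g (p b))" .
      note b = this
      have "l (L (fscale c b + t)) = c * l (g (p b)) + l (L t)"
        by (simp only: L.add L.scale l.add l.scale L(2)[OF step(1)])
      note r = this
      have "(fscale c b + t) (\<lambda>x. l (g x)) = c * b (\<lambda>x. l (g x)) + t (\<lambda>x. l (g x))"
        by (simp only: fscale_apply plus_fun_apply)
      also have "\<dots> = l (L (fscale c b + t))"
        by (simp only: b r step(2))
      finally show ?case .
    qed
    from this[of "eval_at \<Phi> x"] B(3) x have "eval_at \<Phi> x (\<lambda>x. l (g x)) = l (L (eval_at \<Phi> x))"
      by blast
    hence "l (g x) = l (L (eval_at \<Phi> x))" using mem by (simp add: eval_at_def)
    thus False using l(2) by (simp add: l.diff)
  qed
  thus ?thesis using L(1) by blast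
qed

lemma lift:
  assumes "vector_space s"
    and "\<And>l. Vector_Spaces.linear s (*) l \<Longrightarrow> (\<lambda>x. l (g x)) \<in> \<Phi>"
  shows "Vector_Spaces.linear fscale s (lift (eval_at \<Phi>) X s g)"
    and "x \<in> X \<Longrightarrow> lift (eval_at \<Phi>) X s g (eval_at \<Phi> x) = g x"
proof -
  have "Vector_Spaces.linear fscale s (lift (eval_at \<Phi>) X s g) \<and>
    (\<forall>x\<in>X. lift (eval_at \<Phi>) X s g (eval_at \<Phi> x) = g x)"
    using someI_ex[OF lift_exists[where s = s and g = g and \<Phi> = \<Phi> and X = X, OF assms]]
    unfolding lift_def by simp
  thus "Vector_Spaces.linear fscale s (lift (eval_at \<Phi>) X s g)"
    and "x \<in> X \<Longrightarrow> lift (eval_at \<Phi>) X s g (eval_at \<Phi> x) = g x" by auto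
qed

lemma lift_unique:
  fixes e :: "'x \<Rightarrow> 'y \<Rightarrow> 'k::field"
  assumes "Vector_Spaces.linear fscale s L" "Vector_Spaces.linear fscale s L'"
    and "\<And>x. x \<in> X \<Longrightarrow> L (e x) = L' (e x)"
    and "t \<in> module.span fscale (e ` X)"
  shows "L t = L' t"
proof -
  interpret vector_space_pair "fscale :: 'k \<Rightarrow> ('y \<Rightarrow> 'k) \<Rightarrow> _" s
    using assms(1) unfolding vector_space_pair_def Vector_Spaces.linear_iff by blast
  show ?thesis
    using linear_eq_on_span[OF assms(1,2) _ assms(4)] assms(3) by blast
qed


section \<open>Com-PreLie bialgebras\<close>

definition linear_on ::
  "('k::field \<Rightarrow> 'a::ab_group_add \<Rightarrow> 'a) \<Rightarrow> ('k \<Rightarrow> 'b::ab_group_add \<Rightarrow> 'b) \<Rightarrow> 'a set \<Rightarrow> ('a \<Rightarrow> 'b) \<Rightarrow> bool"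
  where
  "linear_on s s' A h \<longleftrightarrow>
     (\<forall>x\<in>A. \<forall>y\<in>A. h (x + y) = h x + h y) \<and> (\<forall>c. \<forall>x\<in>A. h (s c x) = s' c (h x))"

definition bilinear_on ::
  "('k::field \<Rightarrow> 'a::ab_group_add \<Rightarrow> 'a) \<Rightarrow> ('k \<Rightarrow> 'b::ab_group_add \<Rightarrow> 'b) \<Rightarrow> 'a set
    \<Rightarrow> ('a \<Rightarrow> 'a \<Rightarrow> 'b) \<Rightarrow> bool" where
  "bilinear_on s s' A m \<longleftrightarrow>
     (\<forall>a\<in>A. linear_on s s' A (\<lambda>x. m a x)) \<and> (\<forall>a\<in>A. linear_on s s' A (\<lambda>x. m x a))"

definition trilinear_on ::
  "('k::field \<Rightarrow> 'a::ab_group_add \<Rightarrow> 'a) \<Rightarrow> ('k \<Rightarrow> 'b::ab_group_add \<Rightarrow> 'b) \<Rightarrow> 'a set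
    \<Rightarrow> ('a \<Rightarrow> 'a \<Rightarrow> 'a \<Rightarrow> 'b) \<Rightarrow> bool" where
  "trilinear_on s s' A m \<longleftrightarrow>
     (\<forall>a\<in>A. \<forall>b\<in>A. linear_on s s' A (\<lambda>x. m a b x) \<and> linear_on s s' A (\<lambda>x. m a x b)
       \<and> linear_on s s' A (\<lambda>x. m x a b))"

type_synonym ('a, 'k) tensor2 = "('a \<times> 'a \<Rightarrow> 'k) \<Rightarrow> 'k"
type_synonym ('a, 'k) tensor3 = "('a \<times> 'a \<times> 'a \<Rightarrow> 'k) \<Rightarrow> 'k"

definition tens :: "('k::field \<Rightarrow> 'a::ab_group_add \<Rightarrow> 'a) \<Rightarrow> 'a set \<Rightarrow> 'a \<Rightarrow> 'a \<Rightarrow> ('a, 'k) tensor2"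
  where
  "tens s A a b = eval_at {\<beta>. bilinear_on s (*) A (\<lambda>x y. \<beta> (x, y))} (a, b)"

definition tens3 ::
  "('k::field \<Rightarrow> 'a::ab_group_add \<Rightarrow> 'a) \<Rightarrow> 'a set \<Rightarrow> 'a \<Rightarrow> 'a \<Rightarrow> 'a \<Rightarrow> ('a, 'k) tensor3" where
  "tens3 s A a b c = eval_at {\<beta>. trilinear_on s (*) A (\<lambda>x y z. \<beta> (x, y, z))} (a, b, c)"

definition tensor_square ::
  "('k::field \<Rightarrow> 'a::ab_group_add \<Rightarrow> 'a) \<Rightarrow> 'a set \<Rightarrow> ('a, 'k) tensor2 set" where
  "tensor_square s A = module.span fscale {tens s A a b | a b. a \<in> A \<and> b \<in> A}"

text \<open>Sweedler notation: \<open>sweedler s A s' t (\<lambda>a1 a2. g a1 a2)\<close> is the value at \<open>t \<in> A \<otimes> A\<close> of the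
  linear map \<open>a1 \<otimes> a2 \<mapsto> g a1 a2\<close> induced by a bilinear map \<open>g\<close> on \<open>A \<times> A\<close>; see \<open>sweedler_tens\<close>.\<close>

definition sweedler ::
  "('k::field \<Rightarrow> 'a::ab_group_add \<Rightarrow> 'a) \<Rightarrow> 'a set \<Rightarrow> ('k \<Rightarrow> 'c::ab_group_add \<Rightarrow> 'c)
    \<Rightarrow> ('a, 'k) tensor2 \<Rightarrow> ('a \<Rightarrow> 'a \<Rightarrow> 'c) \<Rightarrow> 'c" where
  "sweedler s A s' t g = lift (\<lambda>(a, b). tens s A a b) (A \<times> A) s' (\<lambda>(a, b). g a b) t"

locale com_prelie_algebra = vector_space s
  for s :: "'k::field \<Rightarrow> 'a::ab_group_add \<Rightarrow> 'a" +
  fixes A :: "'a set"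
    and mul :: "'a \<Rightarrow> 'a \<Rightarrow> 'a" (infixl \<open>\<cdot>\<close> 70)
    and bul :: "'a \<Rightarrow> 'a \<Rightarrow> 'a" (infixl \<open>\<bullet>\<close> 70)
  assumes subspace: "subspace A"
    and mul_closed: "\<lbrakk>a \<in> A; b \<in> A\<rbrakk> \<Longrightarrow> a \<cdot> b \<in> A"
    and mul_bilinear: "bilinear_on s s A (\<cdot>)"
    and bul_closed: "\<lbrakk>a \<in> A; b \<in> A\<rbrakk> \<Longrightarrow> a \<bullet> b \<in> A"
    and bul_bilinear: "bilinear_on s s A (\<bullet>)"
    and mul_assoc: "\<lbrakk>a \<in> A; b \<in> A; c \<in> A\<rbrakk> \<Longrightarrow> (a \<cdot> b) \<cdot> c = a \<cdot> (b \<cdot> c)"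
    and mul_commute: "\<lbrakk>a \<in> A; b \<in> A\<rbrakk> \<Longrightarrow> a \<cdot> b = b \<cdot> a"
    and prelie: "\<lbrakk>a \<in> A; b \<in> A; c \<in> A\<rbrakk> \<Longrightarrow>
      (a \<bullet> b) \<bullet> c - a \<bullet> (b \<bullet> c) = (a \<bullet> c) \<bullet> b - a \<bullet> (c \<bullet> b)"
    and derivation: "\<lbrakk>a \<in> A; b \<in> A; c \<in> A\<rbrakk> \<Longrightarrow> (a \<cdot> b) \<bullet> c = (a \<bullet> c) \<cdot> b + a \<cdot> (b \<bullet> c)"

locale bialgebra = vector_space s
  for s :: "'k::field \<Rightarrow> 'a::ab_group_add \<Rightarrow> 'a" +
  fixes A :: "'a set"
    and mul :: "'a \<Rightarrow> 'a \<Rightarrow> 'a" (infixl \<open>\<cdot>\<close> 70)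
    and unit :: 'a
    and \<Delta> :: "'a \<Rightarrow> ('a, 'k) tensor2"
    and \<epsilon> :: "'a \<Rightarrow> 'k"
  assumes subspace: "subspace A"
    and mul_closed: "\<lbrakk>a \<in> A; b \<in> A\<rbrakk> \<Longrightarrow> a \<cdot> b \<in> A"
    and mul_bilinear: "bilinear_on s s A (\<cdot>)"
    and mul_assoc: "\<lbrakk>a \<in> A; b \<in> A; c \<in> A\<rbrakk> \<Longrightarrow> (a \<cdot> b) \<cdot> c = a \<cdot> (b \<cdot> c)"
    and unit_closed: "unit \<in> A"
    and unit_left: "a \<in> A \<Longrightarrow> unit \<cdot> a = a"
    and unit_right: "a \<in> A \<Longrightarrow> a \<cdot> unit = a"
    and comul_closed: "a \<in> A \<Longrightarrow> \<Delta> a \<in> tensor_square s A"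
    and comul_linear: "linear_on s fscale A \<Delta>"
    and counit_linear: "linear_on s (*) A \<epsilon>"
    and coassoc: "a \<in> A \<Longrightarrow>
      sweedler s A fscale (\<Delta> a) (\<lambda>a1 a2. sweedler s A fscale (\<Delta> a1) (\<lambda>b c. tens3 s A b c a2)) =
      sweedler s A fscale (\<Delta> a) (\<lambda>a1 a2. sweedler s A fscale (\<Delta> a2) (\<lambda>b c. tens3 s A a1 b c))"
    and counit_left: "a \<in> A \<Longrightarrow> sweedler s A s (\<Delta> a) (\<lambda>a1 a2. s (\<epsilon> a1) a2) = a"
    and counit_right: "a \<in> A \<Longrightarrow> sweedler s A s (\<Delta> a) (\<lambda>a1 a2. s (\<epsilon> a2) a1) = a"
    and comul_mul: "\<lbrakk>a \<in> A; b \<in> A\<rbrakk> \<Longrightarrow> \<Delta> (a \<cdot> b) =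
      sweedler s A fscale (\<Delta> a) (\<lambda>a1 a2.
        sweedler s A fscale (\<Delta> b) (\<lambda>b1 b2. tens s A (a1 \<cdot> b1) (a2 \<cdot> b2)))"
    and comul_unit: "\<Delta> unit = tens s A unit unit"
    and counit_mul: "\<lbrakk>a \<in> A; b \<in> A\<rbrakk> \<Longrightarrow> \<epsilon> (a \<cdot> b) = \<epsilon> a * \<epsilon> b"
    and counit_unit: "\<epsilon> unit = 1"

text \<open>The unit and counit are not part of the data of a Com-PreLie bialgebra; they are unique
  when they exist.  The existence of the unit makes the Com-PreLie algebra unitary.\<close>

definition com_prelie_bialgebra ::
  "('k::field \<Rightarrow> 'a::ab_group_add \<Rightarrow> 'a) \<Rightarrow> 'a set \<Rightarrow> ('a \<Rightarrow> 'a \<Rightarrow> 'a) \<Rightarrow> ('a \<Rightarrow> 'a \<Rightarrow> 'a)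
    \<Rightarrow> ('a \<Rightarrow> ('a, 'k) tensor2) \<Rightarrow> bool" where
  "com_prelie_bialgebra s A mul bul \<Delta> \<longleftrightarrow>
     com_prelie_algebra s A mul bul \<and>
     (\<exists>unit \<epsilon>. bialgebra s A mul unit \<Delta> \<epsilon>) \<and>
     (\<forall>a\<in>A. \<forall>b\<in>A. \<Delta> (bul a b) =
        sweedler s A fscale (\<Delta> a) (\<lambda>a1 a2. tens s A a1 (bul a2 b)) +
        sweedler s A fscale (\<Delta> a) (\<lambda>a1 a2.
          sweedler s A fscale (\<Delta> b) (\<lambda>b1 b2. tens s A (bul a1 b1) (mul a2 b2))))"


section \<open>The tensor algebra\<close>

definition multilinear ::
  "('k::field \<Rightarrow> 'v::ab_group_add \<Rightarrow> 'v) \<Rightarrow> ('k \<Rightarrow> 'c::ab_group_add \<Rightarrow> 'c) \<Rightarrow> ('v list \<Rightarrow> 'c) \<Rightarrow> bool"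
  where
  "multilinear sV s g \<longleftrightarrow> (\<forall>us vs. Vector_Spaces.linear sV s (\<lambda>x. g (us @ x # vs)))"

text \<open>Unlike the letters, which range over the whole type \<open>'v\<close>, the elements of \<open>T(V)\<close> are the
  members of the subspace \<open>tensor_algebra sV\<close> of the type \<open>('v, 'k) talg\<close>; products and coproducts
  on \<open>T(V)\<close> are total functions whose values outside this subspace are irrelevant.\<close>

type_synonym ('v, 'k) talg = "('v list \<Rightarrow> 'k) \<Rightarrow> 'k"

definition word :: "('k::field \<Rightarrow> 'v::ab_group_add \<Rightarrow> 'v) \<Rightarrow> 'v list \<Rightarrow> ('v, 'k) talg" where
  "word sV w = eval_at {\<phi>. multilinear sV (*) \<phi>} w"

definition tensor_algebra :: "('k::field \<Rightarrow> 'v::ab_group_add \<Rightarrow> 'v) \<Rightarrow> ('v, 'k) talg set" where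
  "tensor_algebra sV = module.span fscale (range (word sV))"

definition tensor_power :: "('k::field \<Rightarrow> 'v::ab_group_add \<Rightarrow> 'v) \<Rightarrow> nat \<Rightarrow> ('v, 'k) talg set" where
  "tensor_power sV n = module.span fscale (word sV ` {w. length w = n})"

definition word_lift :: "('k::field \<Rightarrow> 'v::ab_group_add \<Rightarrow> 'v) \<Rightarrow> ('k \<Rightarrow> 'c::ab_group_add \<Rightarrow> 'c)
    \<Rightarrow> ('v list \<Rightarrow> 'c) \<Rightarrow> ('v, 'k) talg \<Rightarrow> 'c" where
  "word_lift sV s g = lift (word sV) UNIV s g"

text \<open>All shuffles of two lists, with multiplicity (unlike \<^const>\<open>shuffles\<close>).\<close>

fun shuffle_list :: "'v list \<Rightarrow> 'v list \<Rightarrow> 'v list list" where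
  "shuffle_list [] ys = [ys]"
| "shuffle_list (x # xs) [] = [x # xs]"
| "shuffle_list (x # xs) (y # ys) =
     map ((#) x) (shuffle_list xs (y # ys)) @ map ((#) y) (shuffle_list (x # xs) ys)"

text \<open>The operations below are extended linearly from words; that the defining formulas are
  multilinear, so that they do hold on words, is \<open>shuffle_word\<close>, \<open>deconc_word\<close> and
  \<open>f_bullet_word\<close>.\<close>

definition shuffle :: "('k::field \<Rightarrow> 'v::ab_group_add \<Rightarrow> 'v)
    \<Rightarrow> ('v, 'k) talg \<Rightarrow> ('v, 'k) talg \<Rightarrow> ('v, 'k) talg" where
  "shuffle sV s t =
     word_lift sV fscale (\<lambda>u. word_lift sV fscale
       (\<lambda>v. \<Sum>w\<leftarrow>shuffle_list u v. word sV w) t) s"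

definition deconc :: "('k::field \<Rightarrow> 'v::ab_group_add \<Rightarrow> 'v)
    \<Rightarrow> ('v, 'k) talg \<Rightarrow> (('v, 'k) talg, 'k) tensor2" where
  "deconc sV = word_lift sV fscale (\<lambda>w. \<Sum>i\<le>length w.
     tens fscale (tensor_algebra sV) (word sV (take i w)) (word sV (drop i w)))"

text \<open>The product \<open>\<bullet>\<close> of \<open>T(V, f)\<close>.  Positions are counted from 0.\<close>

definition f_bullet :: "('k::field \<Rightarrow> 'v::ab_group_add \<Rightarrow> 'v) \<Rightarrow> ('v \<Rightarrow> 'v)
    \<Rightarrow> ('v, 'k) talg \<Rightarrow> ('v, 'k) talg \<Rightarrow> ('v, 'k) talg" where
  "f_bullet sV f s t =
     word_lift sV fscale (\<lambda>u. word_lift sV fscale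
       (\<lambda>v. \<Sum>i<length u. \<Sum>w\<leftarrow>shuffle_list (drop (Suc i) u) v.
              word sV (take i u @ f (u ! i) # w)) t) s"


subsection \<open>Values on words\<close>

lemma linear_iff_all:
  assumes "vector_space s" "vector_space s'"
  shows "Vector_Spaces.linear s s' h \<longleftrightarrow>
    (\<forall>x y. h (x + y) = h x + h y) \<and> (\<forall>c x. h (s c x) = s' c (h x))"
  using assms by (simp add: Vector_Spaces.linear_iff)

lemma linear_on_tens:
  assumes "vector_space s" "module.subspace s A" "a \<in> A"
  shows "linear_on s fscale A (\<lambda>x. tens s A a x)" "linear_on s fscale A (\<lambda>x. tens s A x a)"
  using assms
  by (auto simp: linear_on_def tens_def eval_at_def fscale_def bilinear_on_def fun_eq_iff
      vector_space_def module.subspace_def)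

lemma sweedler_tens:
  assumes "vector_space s'" "bilinear_on s s' A g" "a \<in> A" "b \<in> A"
  shows "sweedler s A s' (tens s A a b) g = g a b"
proof -
  let ?\<Phi> = "{\<beta>. bilinear_on s (*) A (\<lambda>x y. \<beta> (x, y))}"
  have e: "(\<lambda>(a, b). tens s A a b) = eval_at ?\<Phi>" by (auto simp: tens_def fun_eq_iff)
  have "lift (eval_at ?\<Phi>) (A \<times> A) s' (\<lambda>(a, b). g a b) (eval_at ?\<Phi> (a, b)) = (\<lambda>(a, b). g a b) (a, b)"
  proof (rule lift(2)[OF assms(1)])
    fix l assume "Vector_Spaces.linear s' (*) l"
    then interpret l: Vector_Spaces.linear s' "(*)" l .
    show "(\<lambda>x. l (case x of (a, b) \<Rightarrow> g a b)) \<in> ?\<Phi>"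
      using assms(2) by (auto simp: bilinear_on_def linear_on_def l.add l.scale)
  qed (use assms in auto)
  thus ?thesis unfolding sweedler_def e by (simp add: tens_def)
qed

context
  fixes sV :: "'k::field \<Rightarrow> 'v::ab_group_add \<Rightarrow> 'v"
  assumes sV: "vector_space sV"
begin

lemma subspace_tensor_algebra: "module.subspace fscale (tensor_algebra sV)"
  using module.subspace_span[OF module_fscale] by (simp add: tensor_algebra_def)

lemma word_in_tensor_algebra: "word sV w \<in> tensor_algebra sV"
  unfolding tensor_algebra_def by (rule module.span_base[OF module_fscale]) simp

lemma multilinear_word: "multilinear sV fscale (word sV)"
  unfolding multilinear_def linear_iff_all[OF sV vector_space_fscale]
  by (auto simp: word_def eval_at_def fscale_def fun_eq_iff multilinear_def
      linear_iff_all[OF sV vector_space_mult])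

lemma word_lift:
  assumes s: "vector_space s" and g: "multilinear sV s g"
  shows "Vector_Spaces.linear fscale s (word_lift sV s g)"
    and "word_lift sV s g (word sV w) = g w"
proof -
  have e: "word sV = eval_at {\<phi>. multilinear sV (*) \<phi>}" by (auto simp: word_def fun_eq_iff)
  have l: "(\<lambda>x. l (g x)) \<in> {\<phi>. multilinear sV (*) \<phi>}" if "Vector_Spaces.linear s (*) l" for l
    using g that
    by (simp add: multilinear_def linear_iff_all[OF sV s] linear_iff_all[OF sV vector_space_mult]
        linear_iff_all[OF s vector_space_mult])
  show "Vector_Spaces.linear fscale s (word_lift sV s g)"
    and "word_lift sV s g (word sV w) = g w"
    unfolding word_lift_def e using lift[OF s, of g, OF l, where X = UNIV] by auto
qed

lemma linear_sum_list:
  assumes "vector_space s" "\<And>w. Vector_Spaces.linear sV s (\<lambda>x. h x w)"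
  shows "Vector_Spaces.linear sV s (\<lambda>x. \<Sum>w\<leftarrow>ws. h x w)"
proof -
  interpret vector_space_pair sV s using sV assms(1) by (simp add: vector_space_pair_def)
  show ?thesis by (induction ws) (use assms in \<open>auto intro!: linear_compose_add linear_zero\<close>)
qed

lemma shuffle_list_Nil_right: "shuffle_list xs [] = [xs]"
  by (cases xs) auto

lemma sum_shuffle_list_commute:
  "(\<Sum>w\<leftarrow>shuffle_list u v. G w) = (\<Sum>w\<leftarrow>shuffle_list v u. (G w :: 'c::comm_monoid_add))"
  by (induction u v arbitrary: G rule: shuffle_list.induct)
    (auto simp: shuffle_list_Nil_right o_def add.commute)

lemma multilinear_Cons: "multilinear sV s G \<Longrightarrow> multilinear sV s (\<lambda>w. G (a # w))"
  unfolding multilinear_def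
proof (intro allI)
  fix us vs
  assume "\<forall>us vs. Vector_Spaces.linear sV s (\<lambda>x. G (us @ x # vs))"
  from this[rule_format, of "a # us" vs] show "Vector_Spaces.linear sV s (\<lambda>x. G (a # us @ x # vs))"
    by simp
qed

lemma multilinear_append: "multilinear sV s G \<Longrightarrow> multilinear sV s (\<lambda>w. G (as @ w))"
  unfolding multilinear_def
proof (intro allI)
  fix us vs
  assume "\<forall>us vs. Vector_Spaces.linear sV s (\<lambda>x. G (us @ x # vs))"
  from this[rule_format, of "as @ us" vs] show "Vector_Spaces.linear sV s (\<lambda>x. G (as @ us @ x # vs))"
    by simp
qed

lemma multilinear_shuffle_list_left:
  assumes s: "vector_space s" and "multilinear sV s G"
  shows "multilinear sV s (\<lambda>u. \<Sum>w\<leftarrow>shuffle_list u v. G w)"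
proof -
  interpret vector_space_pair sV s using sV s by (simp add: vector_space_pair_def)
  have G: "Vector_Spaces.linear sV s (\<lambda>x. G (us @ x # vs))" if "multilinear sV s G" for G us vs
    using that by (simp add: multilinear_def)
  have "Vector_Spaces.linear sV s (\<lambda>x. \<Sum>w\<leftarrow>shuffle_list (us @ x # vs) v. G w)" for us vs
    using assms(2)
  proof (induction "length us + length v" arbitrary: us v G rule: less_induct)
    case less
    show ?case
    proof (cases v)
      case Nil
      thus ?thesis using G[OF less.prems] by (simp add: shuffle_list_Nil_right)
    next
      case v: (Cons y ys)
      show ?thesis
      proof (cases us)
        case Nil
        show ?thesis unfolding Nil v
          using less.hyps[of "[]" ys "\<lambda>w. G (y # w)"] multilinear_Cons[OF less.prems]
            G[OF less.prems, of "[]"]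
          by (auto simp: o_def Nil v intro!: linear_compose_add linear_sum_list[OF s])
      next
        case (Cons a as)
        show ?thesis unfolding Cons v
          using less.hyps[of as v "\<lambda>w. G (a # w)"] less.hyps[of us ys "\<lambda>w. G (y # w)"]
            multilinear_Cons[OF less.prems]
          by (auto simp: o_def Cons v intro!: linear_compose_add)
      qed
    qed
  qed
  thus ?thesis by (simp add: multilinear_def)
qed

lemma multilinear_shuffle_list_right:
  assumes "vector_space s" "multilinear sV s G"
  shows "multilinear sV s (\<lambda>v. \<Sum>w\<leftarrow>shuffle_list u v. G w)"
  using multilinear_shuffle_list_left[OF assms, of u] by (simp add: sum_shuffle_list_commute[where u = u])

lemma shuffle_word:
  "shuffle sV (word sV u) (word sV v) = (\<Sum>w\<leftarrow>shuffle_list u v. word sV w)"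
proof -
  have "word_lift sV fscale (\<lambda>v. \<Sum>w\<leftarrow>shuffle_list u v. word sV w) (word sV v) =
    (\<Sum>w\<leftarrow>shuffle_list u v. word sV w)" for u
    by (rule word_lift(2)[OF vector_space_fscale])
      (rule multilinear_shuffle_list_right[OF vector_space_fscale multilinear_word])
  thus ?thesis unfolding shuffle_def
    using word_lift(2)[OF vector_space_fscale
        multilinear_shuffle_list_left[OF vector_space_fscale multilinear_word]] by simp
qed

lemma deconc_word:
  "deconc sV (word sV w) = (\<Sum>i\<le>length w.
     tens fscale (tensor_algebra sV) (word sV (take i w)) (word sV (drop i w)))"
  unfolding deconc_def
proof (rule word_lift(2)[OF vector_space_fscale], unfold multilinear_def, intro allI)
  fix us vs :: "'v list"
  let ?T = "\<lambda>w i. tens fscale (tensor_algebra sV) (word sV (take i w)) (word sV (drop i w))"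
  interpret vector_space_pair sV fscale
    using sV vector_space_fscale by (simp add: vector_space_pair_def)
  note t = linear_on_tens[OF vector_space_fscale subspace_tensor_algebra word_in_tensor_algebra]
  have m: "word sV (us @ (x + y) # vs) = word sV (us @ x # vs) + word sV (us @ y # vs)"
    "word sV (us @ sV c x # vs) = fscale c (word sV (us @ x # vs))" for us vs x y c
    using multilinear_word unfolding multilinear_def linear_iff_all[OF sV vector_space_fscale] by auto
  have "Vector_Spaces.linear sV fscale (\<lambda>x. ?T (us @ x # vs) i)" for i
  proof (cases "i \<le> length us")
    case True
    thus ?thesis using t(1)
      by (auto simp: linear_iff_all[OF sV vector_space_fscale] linear_on_def m word_in_tensor_algebra)
  next
    case False
    then obtain j where "i = Suc (length us + j)" using less_imp_Suc_add not_le by metis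
    thus ?thesis using t(2)
      by (auto simp: linear_iff_all[OF sV vector_space_fscale] linear_on_def m word_in_tensor_algebra)
  qed
  hence "Vector_Spaces.linear sV fscale (\<lambda>x. \<Sum>i\<le>length us + Suc (length vs). ?T (us @ x # vs) i)"
    by (intro linear_compose_sum) auto
  thus "Vector_Spaces.linear sV fscale (\<lambda>x. \<Sum>i\<le>length (us @ x # vs). ?T (us @ x # vs) i)"
    by simp
qed

lemma f_bullet_word:
  assumes f: "Vector_Spaces.linear sV sV f"
  shows "f_bullet sV f (word sV u) (word sV v) =
    (\<Sum>i<length u. \<Sum>w\<leftarrow>shuffle_list (drop (Suc i) u) v. word sV (take i u @ f (u ! i) # w))"
proof -
  interpret vector_space_pair sV fscale
    using sV vector_space_fscale by (simp add: vector_space_pair_def)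
  let ?S = "\<lambda>u v i. \<Sum>w\<leftarrow>shuffle_list (drop (Suc i) u) v. word sV (take i u @ f (u ! i) # w)"
  have pre: "multilinear sV fscale (\<lambda>w. word sV (as @ a # w))" for as a
    using multilinear_append[OF multilinear_word, of "as @ [a]"] by simp
  have "multilinear sV fscale (\<lambda>v. \<Sum>i<length u. ?S u v i)" for u
    using multilinear_shuffle_list_right[OF vector_space_fscale pre] unfolding multilinear_def
    by (intro allI linear_compose_sum) auto
  note inner = word_lift(2)[OF vector_space_fscale this]
  have m: "Vector_Spaces.linear sV fscale (\<lambda>x. word sV (us @ x # vs))" for us vs
    using multilinear_word unfolding multilinear_def by blast
  have mf: "Vector_Spaces.linear sV fscale (\<lambda>x. word sV (us @ f x # vs))" for us vs
    using Vector_Spaces.linear_compose[OF f m[of us vs]] by (simp add: o_def)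
  have "multilinear sV fscale (\<lambda>u. \<Sum>i<length u. ?S u v i)"
    unfolding multilinear_def
  proof (intro allI)
    fix us vs :: "'v list"
    have "Vector_Spaces.linear sV fscale (\<lambda>x. ?S (us @ x # vs) v i)" for i
    proof -
      consider "i < length us" | "i = length us" | "i > length us" by linarith
      thus ?thesis
      proof cases
        case 1
        thus ?thesis using multilinear_shuffle_list_left[OF vector_space_fscale pre]
          by (simp add: multilinear_def nth_append)
      next
        case 2
        thus ?thesis by (auto intro!: linear_sum_list[OF vector_space_fscale] mf)
      next
        case 3
        then obtain j where "i = Suc (length us + j)" using less_imp_Suc_add by metis
        thus ?thesis
          by (auto simp: nth_append intro!: linear_sum_list[OF vector_space_fscale] m)
      qed
    qed
    hence "Vector_Spaces.linear sV fscale
        (\<lambda>x. \<Sum>i<length us + Suc (length vs). ?S (us @ x # vs) v i)"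
      by (intro linear_compose_sum) auto
    thus "Vector_Spaces.linear sV fscale (\<lambda>x. \<Sum>i<length (us @ x # vs). ?S (us @ x # vs) v i)"
      by simp
  qed
  from word_lift(2)[OF vector_space_fscale this] show ?thesis
    unfolding f_bullet_def inner .
qed

end

end

(*  The identities of a Com-PreLie bialgebra are multilinear, so for T(V,f) it suffices to check them on
    words, where all structure constants are natural numbers: they become identities between multisets
    of words, proved by induction on the length and valid for an arbitrary function f on the letters.

    Conversely, let \<bullet> be homogeneous of degree N, and let \<pi> be the projection of T(V) onto the letters.
    Concatenation after (\<pi> \<otimes> id) \<circ> \<Delta> is the identity in positive degrees.  Apply it to xu \<bullet> v and expand
    the coproduct by the compatibility axiom.  The derivation rule gives \<emptyset> \<bullet> v = 0 and, for degree
    reasons, \<pi>(a \<bullet> b) = 0 for words a, b unless a is a letter and b is empty.  Hence xu \<bullet> v equals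
    x(u \<bullet> v) + \<pi>(x \<bullet> \<emptyset>)(u \<squnion> v), which determines \<bullet> by recursion, with f(x) = \<pi>(x \<bullet> \<emptyset>). *)

theory Submission
  imports Defs
begin

section \<open>Shuffles and splittings of words\<close>

text \<open>The words of u \<bullet> v, listed with multiplicity. The sum over the position hit by
  \<open>f\<close> becomes a recursion on whether the first letter is kept or hit; in the second
  case the tail is shuffled with \<open>v\<close>.\<close>

fun bullet_list :: "('v \<Rightarrow> 'v) \<Rightarrow> 'v list \<Rightarrow> 'v list \<Rightarrow> 'v list list" where
  "bullet_list f [] v = []"
| "bullet_list f (x # u) v = map ((#) x) (bullet_list f u v) @ map ((#) (f x)) (shuffle_list u v)"

text \<open>The terms of the deconcatenation of a word, in a recursive form that suits induction on
  the first letter.\<close>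

fun splits :: "'v list \<Rightarrow> ('v list \<times> 'v list) list" where
  "splits [] = [([], [])]"
| "splits (x # w) = ([], x # w) # map (\<lambda>(a, b). (x # a, b)) (splits w)"

text \<open>The two facts below carry a premise on an unrelated vector space of letters, discharged by
  the field of real numbers.\<close>

lemmas sum_shuffle_list_swap = sum_shuffle_list_commute[OF vector_space_mult[where 'k = real]]
lemmas shuffle_list_Nil = shuffle_list_Nil_right[OF vector_space_mult[where 'k = real]]

section \<open>Associativity, derivation rule and pre-Lie identity on words\<close>

lemma sum_list_swap:
  "(\<Sum>x\<leftarrow>xs. \<Sum>y\<leftarrow>ys. F x y) = (\<Sum>y\<leftarrow>ys. \<Sum>x\<leftarrow>xs. (F x y :: 'c::comm_monoid_add))"
  by (induction xs) (simp_all add: sum_list_addf)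

text \<open>Here and below, an equality of multisets of words is expressed by summing an arbitrary
  \<open>G\<close> over them; as \<open>G\<close> is arbitrary, a first letter can be absorbed into
  it and the induction hypothesis applied to the tails. In a triple shuffle the first letter comes
  from \<open>u\<close>, \<open>v\<close> or \<open>z\<close>, which gives the three instances
  used.\<close>

lemma sum_shuffle_list_assoc:
  fixes G :: "'v list \<Rightarrow> 'c::comm_monoid_add"
  shows "(\<Sum>w\<leftarrow>shuffle_list u v. \<Sum>x\<leftarrow>shuffle_list w z. G x) =
    (\<Sum>w\<leftarrow>shuffle_list v z. \<Sum>x\<leftarrow>shuffle_list u w. G x)"
proof (induction "length u + length v + length z" arbitrary: u v z G rule: less_induct)
  case less
  show ?case
  proof (cases "u = [] \<or> v = [] \<or> z = []")
    case True
    thus ?thesis by (auto simp: shuffle_list_Nil)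
  next
    case False
    then obtain a u' b v' c z' where [simp]: "u = a # u'" "v = b # v'" "z = c # z'"
      by (meson neq_Nil_conv)
    show ?thesis
      using less[of u' v z "\<lambda>w. G (a # w)"] less[of u v' z "\<lambda>w. G (b # w)"]
        less[of u v z' "\<lambda>w. G (c # w)"]
      by (simp add: o_def sum_list_addf add_ac)
  qed
qed

lemma sum_shuffle_list_right_commute:
  fixes G :: "'v list \<Rightarrow> 'c::comm_monoid_add"
  shows "(\<Sum>w\<leftarrow>shuffle_list u v. \<Sum>x\<leftarrow>shuffle_list w z. G x) =
    (\<Sum>w\<leftarrow>shuffle_list u z. \<Sum>x\<leftarrow>shuffle_list w v. G x)"
  unfolding sum_shuffle_list_assoc by (rule sum_shuffle_list_swap)

text \<open>Split by the first letter of the result. If it is kept, the induction hypothesis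
  applies; if it is hit by \<open>f\<close>, both sides have a triple shuffle behind it.\<close>

lemma sum_bullet_list_derivation:
  fixes G :: "'v list \<Rightarrow> 'c::comm_monoid_add"
  shows "(\<Sum>w\<leftarrow>shuffle_list u v. \<Sum>x\<leftarrow>bullet_list f w z. G x) =
    (\<Sum>w\<leftarrow>bullet_list f u z. \<Sum>x\<leftarrow>shuffle_list w v. G x) +
    (\<Sum>w\<leftarrow>bullet_list f v z. \<Sum>x\<leftarrow>shuffle_list u w. G x)"
proof (induction u v arbitrary: G rule: shuffle_list.induct)
  case (3 x xs y ys)
  show ?case
    \<comment> \<open>After reassociation, the terms starting with \<open>f x\<close> differ only in
      the order of \<open>z\<close> and \<open>y # ys\<close>.\<close>
    using 3 by (simp add: o_def sum_list_addf sum_shuffle_list_assoc add_ac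
        sum_shuffle_list_swap[where u = z and v = "y # ys"])
qed (auto simp: shuffle_list_Nil o_def)

text \<open>The negative terms of the pre-Lie identity are moved across, so that it makes sense in a
  commutative monoid. Peeling off the first letter of the word leaves the induction hypothesis and
  terms that are symmetric in \<open>b\<close> and \<open>c\<close>.\<close>

lemma sum_bullet_list_prelie:
  fixes G :: "'v list \<Rightarrow> 'c::comm_monoid_add"
  shows "(\<Sum>w\<leftarrow>bullet_list f a b. \<Sum>x\<leftarrow>bullet_list f w c. G x) +
      (\<Sum>w\<leftarrow>bullet_list f c b. \<Sum>x\<leftarrow>bullet_list f a w. G x) =
    (\<Sum>w\<leftarrow>bullet_list f a c. \<Sum>x\<leftarrow>bullet_list f w b. G x) +
      (\<Sum>w\<leftarrow>bullet_list f b c. \<Sum>x\<leftarrow>bullet_list f a w. G x)"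
proof (induction a arbitrary: G)
  case (Cons x a)
  let ?P = "\<lambda>a b c G. (\<Sum>w\<leftarrow>bullet_list f a b. \<Sum>x\<leftarrow>bullet_list f w c. G x) +
    (\<Sum>w\<leftarrow>bullet_list f c b. \<Sum>x\<leftarrow>bullet_list f a w. (G x :: 'c))"
  \<comment> \<open>All three collect terms in which \<open>x\<close> is hit: in \<open>?S\<close> a
    letter of \<open>a\<close> is hit as well, in \<open>?T\<close> a letter of the first argument
    \<open>b\<close>, and in \<open>?U\<close> the letter \<open>x\<close> is hit twice.\<close>
  let ?S = "\<lambda>b c. \<Sum>w\<leftarrow>bullet_list f a b. \<Sum>x'\<leftarrow>shuffle_list w c. G (f x # x')"
  let ?T = "\<lambda>b c. \<Sum>w\<leftarrow>bullet_list f b c. \<Sum>x'\<leftarrow>shuffle_list a w. G (f x # x')"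
  let ?U = "\<lambda>b c. \<Sum>w\<leftarrow>shuffle_list a b. \<Sum>x'\<leftarrow>shuffle_list w c. G (f (f x) # x')"
  have "?P (x # a) b c G = ?P a b c (\<lambda>w. G (x # w)) + (?S b c + ?S c b + (?T b c + ?T c b) + ?U b c)"
    for b c
    by (simp add: o_def sum_list_addf sum_bullet_list_derivation add_ac)
  note this[of b c] this[of c b]
  \<comment> \<open>The \<open>?S\<close> and \<open>?T\<close> terms already occur in both orders;
    only \<open>?U\<close> needs an argument.\<close>
  moreover have "?U b c = ?U c b" by (rule sum_shuffle_list_right_commute)
  moreover have "?P a b c (\<lambda>w. G (x # w)) = ?P a c b (\<lambda>w. G (x # w))" by (rule Cons)
  ultimately show ?case by (simp only: add_ac)
qed auto

section \<open>Deconcatenation on words: compatibility with both products, coassociativity\<close>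

text \<open>Used instead of \<open>splits.simps(2)\<close>: it keeps a sum over
  \<open>splits w\<close> in the shape of the induction hypotheses.\<close>

lemma sum_splits_Cons:
  fixes G :: "'v list \<Rightarrow> 'v list \<Rightarrow> 'c::comm_monoid_add"
  shows "(\<Sum>(p, q)\<leftarrow>splits (x # w). G p q) = G [] (x # w) + (\<Sum>(p, q)\<leftarrow>splits w. G (x # p) q)"
  by (simp add: case_prod_unfold o_def)

lemma sum_list_case_prod_add:
  fixes F G :: "'a \<Rightarrow> 'b \<Rightarrow> 'c::comm_monoid_add"
  shows "(\<Sum>(p, q)\<leftarrow>ps. F p q + G p q) = (\<Sum>(p, q)\<leftarrow>ps. F p q) + (\<Sum>(p, q)\<leftarrow>ps. G p q)"
  by (simp add: case_prod_unfold sum_list_addf)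

lemma sum_list_case_prod_zero: "(\<Sum>(p, q)\<leftarrow>ps. 0) = (0 :: 'c::comm_monoid_add)"
  by (simp add: case_prod_unfold)

text \<open>Cutting a shuffle cuts both words: its prefix is a shuffle of prefixes and its suffix a
  shuffle of suffixes.\<close>

lemma sum_splits_shuffle_list:
  fixes G :: "'v list \<Rightarrow> 'v list \<Rightarrow> 'c::comm_monoid_add"
  shows "(\<Sum>w\<leftarrow>shuffle_list u v. \<Sum>(p, q)\<leftarrow>splits w. G p q) =
    (\<Sum>(u1, u2)\<leftarrow>splits u. \<Sum>(v1, v2)\<leftarrow>splits v.
      \<Sum>p\<leftarrow>shuffle_list u1 v1. \<Sum>q\<leftarrow>shuffle_list u2 v2. G p q)"
proof (induction u v arbitrary: G rule: shuffle_list.induct)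
  case (3 x xs y ys)
  show ?case
    by (simp add: 3 sum_splits_Cons sum_list_case_prod_add o_def sum_list_addf add_ac
        shuffle_list_Nil del: splits.simps(2))
qed (auto simp: shuffle_list_Nil o_def case_prod_unfold)

text \<open>Two kinds of cuts. Before the letter hit by \<open>f\<close>, the prefix is an untouched
  part of \<open>u\<close> and all of \<open>v\<close> stays on the right; after that letter, the
  prefix contains it and the cut also divides \<open>v\<close>.\<close>

lemma sum_splits_bullet_list:
  fixes G :: "'v list \<Rightarrow> 'v list \<Rightarrow> 'c::comm_monoid_add"
  shows "(\<Sum>w\<leftarrow>bullet_list f u v. \<Sum>(p, q)\<leftarrow>splits w. G p q) =
    (\<Sum>(u1, u2)\<leftarrow>splits u. \<Sum>q\<leftarrow>bullet_list f u2 v. G u1 q) +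
    (\<Sum>(u1, u2)\<leftarrow>splits u. \<Sum>(v1, v2)\<leftarrow>splits v.
      \<Sum>p\<leftarrow>bullet_list f u1 v1. \<Sum>q\<leftarrow>shuffle_list u2 v2. G p q)"
proof (induction u arbitrary: G)
  case (Cons x u)
  show ?case
    by (simp add: Cons sum_splits_Cons sum_list_case_prod_add o_def sum_list_addf add_ac
        sum_splits_shuffle_list sum_list_case_prod_zero del: splits.simps(2))
qed (auto simp: case_prod_unfold)

text \<open>Both sides run over the factorisations of \<open>w\<close> into three words.\<close>

lemma sum_splits_coassoc:
  fixes G :: "'v list \<Rightarrow> 'v list \<Rightarrow> 'v list \<Rightarrow> 'c::comm_monoid_add"
  shows "(\<Sum>(p, q)\<leftarrow>splits w. \<Sum>(a, b)\<leftarrow>splits p. G a b q) =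
    (\<Sum>(p, q)\<leftarrow>splits w. \<Sum>(a, b)\<leftarrow>splits q. G p a b)"
  by (induction w arbitrary: G)
    (simp_all add: sum_splits_Cons sum_list_case_prod_add add_ac del: splits.simps(2))

section \<open>Comparison of the recursive lists with the formulas by positions\<close>

lemma sum_splits_eq_sum_take_drop:
  fixes G :: "'v list \<Rightarrow> 'v list \<Rightarrow> 'c::comm_monoid_add"
  shows "(\<Sum>(p, q)\<leftarrow>splits w. G p q) = (\<Sum>i\<le>length w. G (take i w) (drop i w))"
  by (induction w arbitrary: G)
    (simp_all add: sum_splits_Cons sum.atMost_Suc_shift del: sum.atMost_Suc splits.simps(2))

lemma sum_bullet_list_eq:
  fixes G :: "'v list \<Rightarrow> 'c::comm_monoid_add"
  shows "(\<Sum>w\<leftarrow>bullet_list f u v. G w) =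
    (\<Sum>i<length u. \<Sum>w\<leftarrow>shuffle_list (drop (Suc i) u) v. G (take i u @ f (u ! i) # w))"
  by (induction u arbitrary: G)
    (simp_all add: o_def sum.lessThan_Suc_shift add_ac del: sum.lessThan_Suc)

text \<open>Serves the counit and the search for the terms of a coproduct that survive the
  projection onto letters.\<close>

lemma sum_splits_eq_first:
  assumes "\<And>a b. a \<noteq> [] \<Longrightarrow> G a b = (0 :: 'c::comm_monoid_add)"
  shows "(\<Sum>(a, b)\<leftarrow>splits w. G a b) = G [] w"
  using assms by (cases w) (simp_all add: case_prod_unfold o_def)

section \<open>Multilinear maps on the tensor algebra\<close>

lemma bilinear_onI:
  assumes "\<And>a x y. \<lbrakk>a \<in> A; x \<in> A; y \<in> A\<rbrakk> \<Longrightarrow> m a (x + y) = m a x + m a y"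
    and "\<And>a x y. \<lbrakk>a \<in> A; x \<in> A; y \<in> A\<rbrakk> \<Longrightarrow> m (x + y) a = m x a + m y a"
    and "\<And>a x c. \<lbrakk>a \<in> A; x \<in> A\<rbrakk> \<Longrightarrow> m a (s c x) = s' c (m a x)"
    and "\<And>a x c. \<lbrakk>a \<in> A; x \<in> A\<rbrakk> \<Longrightarrow> m (s c x) a = s' c (m x a)"
  shows "bilinear_on s s' A m"
  using assms by (simp add: bilinear_on_def linear_on_def)

lemma bilinear_onD:
  assumes "bilinear_on s s' A m"
  shows "\<And>a x y. \<lbrakk>a \<in> A; x \<in> A; y \<in> A\<rbrakk> \<Longrightarrow> m a (x + y) = m a x + m a y"
    and "\<And>a x y. \<lbrakk>a \<in> A; x \<in> A; y \<in> A\<rbrakk> \<Longrightarrow> m (x + y) a = m x a + m y a"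
    and "\<And>a x c. \<lbrakk>a \<in> A; x \<in> A\<rbrakk> \<Longrightarrow> m a (s c x) = s' c (m a x)"
    and "\<And>a x c. \<lbrakk>a \<in> A; x \<in> A\<rbrakk> \<Longrightarrow> m (s c x) a = s' c (m x a)"
  using assms by (simp_all add: bilinear_on_def linear_on_def)

lemma linear_imp_linear_on: "Vector_Spaces.linear s s' h \<Longrightarrow> linear_on s s' A h"
  by (simp add: linear_on_def Vector_Spaces.linear_iff)

lemma linear_sum_list_image:
  assumes "Vector_Spaces.linear s s' h"
  shows "h (\<Sum>x\<leftarrow>xs. F x) = (\<Sum>x\<leftarrow>xs. h (F x))"
proof -
  interpret h: Vector_Spaces.linear s s' h by (rule assms)
  show ?thesis by (induction xs) (simp_all add: h.add h.zero)
qed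

lemma linear_on_zero:
  assumes "linear_on s s' A h" "vector_space s" "vector_space s'" "module.subspace s A"
  shows "h 0 = 0"
proof -
  interpret s: vector_space s by fact
  interpret s': vector_space s' by fact
  have "h (s 0 0) = s' 0 (h 0)"
    using assms(1) s.subspace_0[OF assms(4)] unfolding linear_on_def by blast
  thus ?thesis by simp
qed

lemma linear_on_sum_list:
  assumes h: "linear_on s s' A h" and s: "vector_space s" "vector_space s'"
    and A: "module.subspace s A" and F: "\<And>x. F x \<in> A"
  shows "h (\<Sum>x\<leftarrow>xs. F x) = (\<Sum>x\<leftarrow>xs. h (F x))"
proof -
  interpret s: vector_space s by fact
  have mem: "(\<Sum>x\<leftarrow>xs. F x) \<in> A" for xs
    by (induction xs) (auto simp: s.subspace_0[OF A] s.subspace_add[OF A] F)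
  show ?thesis
  proof (induction xs)
    case Nil
    show ?case using linear_on_zero[OF h s A] by simp
  next
    case (Cons x xs)
    thus ?case using h F mem by (simp add: linear_on_def)
  qed
qed

lemma sum_list_in_subspace:
  assumes "vector_space s" "module.subspace s A" "\<And>x. F x \<in> A"
  shows "(\<Sum>x\<leftarrow>xs. F x) \<in> A"
proof -
  interpret s: vector_space s by fact
  show ?thesis
    by (induction xs) (auto simp: s.subspace_0[OF assms(2)] s.subspace_add[OF assms(2)] assms(3))
qed

text \<open>Linearity holds on all functionals, not only on \<open>tensor_square\<close>, since
  \<open>lift\<close> selects a map that is linear everywhere.\<close>

lemma linear_sweedler:
  assumes "vector_space s'" "bilinear_on s s' A g"
  shows "Vector_Spaces.linear fscale s' (\<lambda>t. sweedler s A s' t g)"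
proof -
  let ?\<Phi> = "{\<beta>. bilinear_on s (*) A (\<lambda>x y. \<beta> (x, y))}"
  have e: "(\<lambda>(a, b). tens s A a b) = eval_at ?\<Phi>" by (auto simp: tens_def fun_eq_iff)
  have "Vector_Spaces.linear fscale s' (lift (eval_at ?\<Phi>) (A \<times> A) s' (\<lambda>(a, b). g a b))"
  proof (rule lift(1)[OF assms(1)])
    fix l assume "Vector_Spaces.linear s' (*) l"
    then interpret l: Vector_Spaces.linear s' "(*)" l .
    show "(\<lambda>x. l (case x of (a, b) \<Rightarrow> g a b)) \<in> ?\<Phi>"
      using assms(2) by (auto simp: bilinear_on_def linear_on_def l.add l.scale)
  qed
  thus ?thesis unfolding sweedler_def e by (simp add: eta_contract_eq)
qed

lemma trilinear_tens3:
  assumes "vector_space s" "module.subspace s A"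
  shows "trilinear_on s fscale A (tens3 s A)"
  using assms
  by (auto simp: trilinear_on_def linear_on_def tens3_def eval_at_def fscale_def fun_eq_iff
      vector_space_def module.subspace_def)

text \<open>The four argument patterns are those of associativity, the derivation rule and the
  pre-Lie identity.\<close>

lemma trilinear_compose:
  assumes m: "bilinear_on s s' A m" and m': "bilinear_on s s A m'"
    and cl: "\<forall>a\<in>A. \<forall>b\<in>A. m' a b \<in> A"
  shows "trilinear_on s s' A (\<lambda>a b c. m (m' a b) c)"
    and "trilinear_on s s' A (\<lambda>a b c. m a (m' b c))"
    and "trilinear_on s s' A (\<lambda>a b c. m (m' a c) b)"
    and "trilinear_on s s' A (\<lambda>a b c. m a (m' c b))"
  using m m' cl by (auto simp: trilinear_on_def linear_on_def bilinear_on_def)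

lemma trilinear_add:
  assumes "vector_space s'" "trilinear_on s s' A m" "trilinear_on s s' A m'"
  shows "trilinear_on s s' A (\<lambda>a b c. m a b c + m' a b c)"
proof -
  interpret vector_space s' by fact
  show ?thesis using assms(2,3)
    by (simp add: trilinear_on_def linear_on_def scale_right_distrib ac_simps)
qed

text \<open>Provides the two hypotheses of \<open>sweedler_sweedler\<close> for the integrands of
  double Sweedler sums.\<close>

lemma quadrilinear_tens:
  assumes "vector_space s" "module.subspace s A"
    and m: "bilinear_on s s A m" "\<forall>a\<in>A. \<forall>b\<in>A. m a b \<in> A"
    and m': "bilinear_on s s A m'" "\<forall>a\<in>A. \<forall>b\<in>A. m' a b \<in> A"
    and "x \<in> A" "y \<in> A"
  shows "bilinear_on s fscale A (\<lambda>b1 b2. tens s A (m x b1) (m' y b2))"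
    and "bilinear_on s fscale A (\<lambda>a1 a2. tens s A (m a1 x) (m' a2 y))"
  using assms(3-) linear_on_tens[OF assms(1,2)]
  by (simp_all add: bilinear_on_def linear_on_def)

section \<open>Extension from words to the tensor algebra\<close>

context
  fixes sV :: "'k::field \<Rightarrow> 'v::ab_group_add \<Rightarrow> 'v"
  assumes sV: "vector_space sV"
begin

private abbreviation (input) "T \<equiv> tensor_algebra sV"
private abbreviation (input) "W \<equiv> word sV"

text \<open>The elements of T(V) with image in \<open>U\<close> form a subspace that contains the
  words, hence everything.\<close>

lemma image_in_subspace:
  assumes h: "linear_on fscale s T h" and s: "vector_space s"
    and U: "module.subspace s U" "\<And>w. h (W w) \<in> U" and t: "t \<in> T"
  shows "h t \<in> U"
proof -
  interpret s: vector_space s by fact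
  interpret f: vector_space fscale by (rule vector_space_fscale)
  note sub = subspace_tensor_algebra[OF sV]
  have "f.subspace {t \<in> T. h t \<in> U}"
    using h linear_on_zero[OF h vector_space_fscale s sub] U(1)
    by (auto simp: f.subspace_def linear_on_def s.subspace_0 s.subspace_add s.subspace_scale
        f.subspace_0[OF sub] f.subspace_add[OF sub] f.subspace_scale[OF sub])
  from f.span_minimal[OF _ this, of "range W"] U(2) word_in_tensor_algebra[OF sV]
  have "T \<subseteq> {t \<in> T. h t \<in> U}" by (auto simp: tensor_algebra_def)
  thus ?thesis using t by blast
qed

lemma eq_on_tensor_algebra:
  assumes F: "linear_on fscale s T F" and G: "linear_on fscale s T G"
    and s: "vector_space s" and w: "\<And>w. F (W w) = G (W w)"
    and t: "t \<in> T"
  shows "F t = G t"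
proof -
  interpret s: vector_space s by fact
  have "linear_on fscale s T (\<lambda>t. F t - G t)"
    using F G by (simp add: linear_on_def s.scale_right_diff_distrib)
  \<comment> \<open>Equality is membership of the difference in the zero subspace.\<close>
  from image_in_subspace[OF this s s.subspace_single_0 _ t] w show ?thesis by auto
qed

lemma trilinear_eq_on_tensor_algebra:
  assumes F: "trilinear_on fscale s T F"
    and G: "trilinear_on fscale s T G"
    and s: "vector_space s"
    and w: "\<And>u v w. F (W u) (W v) (W w) = G (W u) (W v) (W w)"
    and t: "a \<in> T" "b \<in> T" "c \<in> T"
  shows "F a b c = G a b c"
proof -
  note W = word_in_tensor_algebra[OF sV]
  note e = eq_on_tensor_algebra[OF _ _ s]
  have l: "linear_on fscale s T (\<lambda>x. F y z x)"
    "linear_on fscale s T (\<lambda>x. F y x z)"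
    "linear_on fscale s T (\<lambda>x. F x y z)"
    "linear_on fscale s T (\<lambda>x. G y z x)"
    "linear_on fscale s T (\<lambda>x. G y x z)"
    "linear_on fscale s T (\<lambda>x. G x y z)"
    if "y \<in> T" "z \<in> T" for y z
    using F G that by (simp_all add: trilinear_on_def)
  \<comment> \<open>The arguments are freed from being words one at a time, from the last to the
    first.\<close>
  have 1: "F (W u) (W v) c = G (W u) (W v) c" for u v
    by (rule e[OF l(1) l(4) w t(3)]) (rule W)+
  have 2: "F (W u) b c = G (W u) b c" for u
    by (rule e[OF l(2) l(5) 1 t(2)]) (rule W t)+
  show ?thesis
    by (rule e[OF l(3) l(6) 2 t(1)]) (rule t)+
qed

lemma bilinear_eq_on_tensor_algebra:
  assumes F: "bilinear_on fscale s T F"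
    and G: "bilinear_on fscale s T G"
    and s: "vector_space s"
    and w: "\<And>u v. F (W u) (W v) = G (W u) (W v)"
    and t: "a \<in> T" "b \<in> T"
  shows "F a b = G a b"
proof -
  note e = eq_on_tensor_algebra[OF _ _ s]
  have l: "linear_on fscale s T (\<lambda>x. F y x)"
    "linear_on fscale s T (\<lambda>x. F x y)"
    "linear_on fscale s T (\<lambda>x. G y x)"
    "linear_on fscale s T (\<lambda>x. G x y)"
    if "y \<in> T" for y
    using F G that by (simp_all add: bilinear_on_def)
  have 1: "F (W u) b = G (W u) b" for u
    by (rule e[OF l(1) l(3) w t(2)]) (rule word_in_tensor_algebra[OF sV])+
  show ?thesis
    by (rule e[OF l(2) l(4) 1 t(1)]) (rule t)+
qed

text \<open>A nested \<open>word_lift\<close> can only be evaluated once the inner lift is known to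
  be multilinear in the outer word \<open>u\<close>.\<close>

lemma bilinear_word_lift:
  assumes s: "vector_space s"
    and l: "\<And>v. multilinear sV s (\<lambda>u. h u v)" and r: "\<And>u. multilinear sV s (h u)"
  defines "H \<equiv> \<lambda>x y. word_lift sV s (\<lambda>u. word_lift sV s (h u) y) x"
  shows "bilinear_on fscale s T H"
    and "H (W u) (W v) = h u v"
proof -
  interpret s: vector_space s by fact
  interpret f: vector_space fscale by (rule vector_space_fscale)
  note sub = subspace_tensor_algebra[OF sV]
  note lin = linear_iff_all[OF vector_space_fscale s]
  note linV = linear_iff_all[OF sV s]
  note r1 = word_lift(1)[OF sV s r, unfolded lin]
  note r2 = word_lift(2)[OF sV s r]
  have l': "h (us @ (x + x') # vs) v = h (us @ x # vs) v + h (us @ x' # vs) v"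
    "h (us @ sV c x # vs) v = s c (h (us @ x # vs) v)" for us vs x x' v c
    using l[of v] unfolding multilinear_def linV by auto
  \<comment> \<open>The restriction to T(V) matters: each inner lift is chosen separately for its
    word \<open>u\<close>, and only its values on the span of the words are determined.\<close>
  have m: "multilinear sV s (\<lambda>u. word_lift sV s (h u) y)" if y: "y \<in> T" for y
    unfolding multilinear_def linV
  proof (intro allI conjI)
    fix us vs x x' c
    show "word_lift sV s (h (us @ (x + x') # vs)) y =
      word_lift sV s (h (us @ x # vs)) y + word_lift sV s (h (us @ x' # vs)) y"
      by (rule eq_on_tensor_algebra[OF _ _ s _ y])
        (simp_all add: linear_on_def r1 s.scale_right_distrib, simp only: r2, simp only: l')
    show "word_lift sV s (h (us @ sV c x # vs)) y = s c (word_lift sV s (h (us @ x # vs)) y)"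
      by (rule eq_on_tensor_algebra[OF _ _ s _ y])
        (simp_all add: linear_on_def r1 s.scale_right_distrib mult.commute, simp only: r2, simp only: l')
  qed
  have H1: "H (x + x') y = H x y + H x' y" "H (fscale c x) y = s c (H x y)"
    if "y \<in> T" for x x' y c
    using word_lift(1)[OF sV s m[OF that], unfolded lin] by (auto simp: H_def)
  have H2: "H (W w) y = word_lift sV s (h w) y" if "y \<in> T" for w y
    unfolding H_def by (rule word_lift(2)[OF sV s m[OF that]])
  show "H (W u) (W v) = h u v"
    unfolding H2[OF word_in_tensor_algebra[OF sV]] by (rule r2)
  show "bilinear_on fscale s T H"
  proof (rule bilinear_onI)
    fix a x y c assume a: "a \<in> T" and x: "x \<in> T"
    show "H (fscale c x) a = s c (H x a)" by (rule H1(2)[OF a])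
    show "H a (fscale c x) = s c (H a x)"
      by (rule eq_on_tensor_algebra[OF _ _ s _ a])
        (simp_all add: linear_on_def x r1 H1 H2 f.subspace_scale[OF sub] s.scale_right_distrib mult.commute)
    assume y: "y \<in> T"
    show "H (x + y) a = H x a + H y a" by (rule H1(1)[OF a])
    show "H a (x + y) = H a x + H a y"
      by (rule eq_on_tensor_algebra[OF _ _ s _ a])
        (simp_all add: linear_on_def x y r1 H1 H2 f.subspace_add[OF sub] s.scale_right_distrib ac_simps del: plus_fun_apply)
  qed
qed

section \<open>Multilinearity of the sums over \<open>bullet_list\<close> and
  \<open>splits\<close>\<close>

lemma multilinear_bullet_list_right:
  assumes s: "vector_space s" and G: "multilinear sV s G"
  shows "multilinear sV s (\<lambda>v. \<Sum>w\<leftarrow>bullet_list f u v. G w)"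
  using G
proof (induction u arbitrary: G)
  case Nil
  interpret vector_space_pair sV s using sV s by (simp add: vector_space_pair_def)
  show ?case by (simp add: multilinear_def linear_zero)
next
  case (Cons x u)
  interpret vector_space_pair sV s using sV s by (simp add: vector_space_pair_def)
  show ?case
    using Cons.IH[OF multilinear_Cons[OF sV Cons.prems, of x]]
      multilinear_shuffle_list_right[OF sV s multilinear_Cons[OF sV Cons.prems, of "f x"], of u]
    by (simp add: multilinear_def o_def linear_compose_add)
qed

text \<open>Linearity of \<open>f\<close> enters when the varying letter is itself the one that is
  hit.\<close>

lemma multilinear_bullet_list_left:
  assumes s: "vector_space s" and G: "multilinear sV s G" and f: "Vector_Spaces.linear sV sV f"
  shows "multilinear sV s (\<lambda>u. \<Sum>w\<leftarrow>bullet_list f u v. G w)"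
  unfolding multilinear_def
proof (intro allI)
  interpret vector_space_pair sV s using sV s by (simp add: vector_space_pair_def)
  fix us vs
  show "Vector_Spaces.linear sV s (\<lambda>x. \<Sum>w\<leftarrow>bullet_list f (us @ x # vs) v. G w)"
    using G
  proof (induction us arbitrary: G)
    case Nil
    have g: "Vector_Spaces.linear sV s (\<lambda>x. G (x # w))" for w
      using Nil[unfolded multilinear_def, rule_format, of "[]" w] by simp
    have "Vector_Spaces.linear sV s (\<lambda>x. G (f x # w))" for w
      using Vector_Spaces.linear_compose[OF f g] by (simp add: o_def)
    thus ?case using g
      by (simp add: o_def linear_compose_add linear_sum_list[OF sV s])
  next
    case (Cons a us)
    show ?case
      using Cons.IH[OF multilinear_Cons[OF sV Cons.prems, of a]]
        multilinear_shuffle_list_left[OF sV s multilinear_Cons[OF sV Cons.prems, of "f a"], of v]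
      by (simp add: o_def multilinear_def linear_compose_add)
  qed
qed

lemma multilinear_splits:
  assumes s: "vector_space s"
    and "\<And>q. multilinear sV s (\<lambda>p. G p q)" "\<And>p. multilinear sV s (\<lambda>q. G p q)"
  shows "multilinear sV s (\<lambda>w. \<Sum>(p, q)\<leftarrow>splits w. G p q)"
  unfolding multilinear_def
proof (intro allI)
  interpret vector_space_pair sV s using sV s by (simp add: vector_space_pair_def)
  fix us vs
  show "Vector_Spaces.linear sV s (\<lambda>x. \<Sum>(p, q)\<leftarrow>splits (us @ x # vs). G p q)"
    using assms(2,3)
  proof (induction us arbitrary: G)
    case Nil
    have "Vector_Spaces.linear sV s (\<lambda>x. G [] (x # vs))" "Vector_Spaces.linear sV s (\<lambda>x. G (x # p) q)"
      for p q
      using Nil(1)[unfolded multilinear_def, rule_format, of "[]"]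
        Nil(2)[unfolded multilinear_def, rule_format, of _ "[]"] by simp_all
    thus ?case
      by (auto simp: o_def case_prod_unfold intro!: linear_compose_add linear_sum_list[OF sV s])
  next
    case (Cons a us)
    have "Vector_Spaces.linear sV s (\<lambda>x. G [] ((a # us) @ x # vs))"
      using Cons.prems(2) unfolding multilinear_def by blast
    thus ?case
      using Cons.IH[of "\<lambda>p. G (a # p)", OF multilinear_Cons[OF sV Cons.prems(1)] Cons.prems(2)]
      by (simp add: o_def case_prod_unfold linear_compose_add)
  qed
qed

subsection \<open>The Com-PreLie bialgebra of an endomorphism\<close>

lemma bilinear_closed:
  assumes "bilinear_on fscale fscale T m" "\<And>u v. m (W u) (W v) \<in> T" "a \<in> T" "b \<in> T"
  shows "m a b \<in> T"
proof -
  have l: "linear_on fscale fscale T (\<lambda>x. m y x)" "linear_on fscale fscale T (\<lambda>x. m x y)"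
    if "y \<in> T" for y
    using assms(1) that by (simp_all add: bilinear_on_def)
  note i = image_in_subspace[OF _ vector_space_fscale subspace_tensor_algebra[OF sV]]
  have "m (W u) b \<in> T" for u
    by (rule i[OF l(1)]) (use assms word_in_tensor_algebra[OF sV] in auto)
  thus ?thesis
    by (intro i[OF l(2), of b a]) (use assms in auto)
qed

lemma word_sum_in_tensor_algebra: "(\<Sum>w\<leftarrow>ws. W w) \<in> T"
  by (rule sum_list_in_subspace[OF vector_space_fscale subspace_tensor_algebra[OF sV]
      word_in_tensor_algebra[OF sV]])

lemma bilinear_word_sum:
  assumes "vector_space s" "bilinear_on fscale s T m" "c \<in> T"
  shows "m (\<Sum>w\<leftarrow>ws. W w) c = (\<Sum>w\<leftarrow>ws. m (W w) c)"
    and "m c (\<Sum>w\<leftarrow>ws. W w) = (\<Sum>w\<leftarrow>ws. m c (W w))"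
  using assms(2,3) unfolding bilinear_on_def
  by (auto intro!: linear_on_sum_list[OF _ vector_space_fscale assms(1) subspace_tensor_algebra[OF sV]
        word_in_tensor_algebra[OF sV]])

lemma bilinear_shuffle: "bilinear_on fscale fscale T (shuffle sV)"
  unfolding shuffle_def[abs_def]
  by (rule bilinear_word_lift(1)[OF vector_space_fscale])
    (rule multilinear_shuffle_list_left[OF sV vector_space_fscale multilinear_word[OF sV]]
      multilinear_shuffle_list_right[OF sV vector_space_fscale multilinear_word[OF sV]])+

lemma shuffle_closed: "\<lbrakk>a \<in> T; b \<in> T\<rbrakk> \<Longrightarrow> shuffle sV a b \<in> T"
  by (rule bilinear_closed[OF bilinear_shuffle])
    (simp_all add: shuffle_word[OF sV] word_sum_in_tensor_algebra)

lemma f_bullet_word_sum_list: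
  assumes "Vector_Spaces.linear sV sV f"
  shows "f_bullet sV f (W u) (W v) = (\<Sum>w\<leftarrow>bullet_list f u v. W w)"
  unfolding f_bullet_word[OF sV assms] sum_bullet_list_eq ..

lemma bilinear_f_bullet:
  assumes "Vector_Spaces.linear sV sV f"
  shows "bilinear_on fscale fscale T (f_bullet sV f)"
  unfolding f_bullet_def[abs_def] sum_bullet_list_eq[symmetric]
  by (rule bilinear_word_lift(1)[OF vector_space_fscale])
    (rule multilinear_bullet_list_left[OF vector_space_fscale multilinear_word[OF sV] assms]
      multilinear_bullet_list_right[OF vector_space_fscale multilinear_word[OF sV]])+

lemma f_bullet_closed:
  assumes "Vector_Spaces.linear sV sV f"
  shows "\<lbrakk>a \<in> T; b \<in> T\<rbrakk> \<Longrightarrow> f_bullet sV f a b \<in> T"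
  by (rule bilinear_closed[OF bilinear_f_bullet[OF assms]])
    (simp_all add: f_bullet_word_sum_list[OF assms] word_sum_in_tensor_algebra)

lemma shuffle_commute: "\<lbrakk>a \<in> T; b \<in> T\<rbrakk> \<Longrightarrow> shuffle sV a b = shuffle sV b a"
proof (rule bilinear_eq_on_tensor_algebra[OF bilinear_shuffle _ vector_space_fscale])
  show "bilinear_on fscale fscale T (\<lambda>a b. shuffle sV b a)"
    using bilinear_shuffle by (simp add: bilinear_on_def)
  show "shuffle sV (W u) (W v) = shuffle sV (W v) (W u)" for u v
    unfolding shuffle_word[OF sV] by (rule sum_shuffle_list_commute[OF sV])
qed

lemma shuffle_unit: "a \<in> T \<Longrightarrow> shuffle sV (W []) a = a"
  by (rule eq_on_tensor_algebra[OF _ _ vector_space_fscale, where G = "\<lambda>a. a"])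
    (use bilinear_shuffle word_in_tensor_algebra[OF sV]
      in \<open>auto simp: bilinear_on_def shuffle_word[OF sV] linear_on_def\<close>)

lemma com_prelie_f_bullet:
  assumes f: "Vector_Spaces.linear sV sV f"
  shows "com_prelie_algebra fscale T (shuffle sV) (f_bullet sV f)"
proof -
  interpret vector_space "fscale :: 'k \<Rightarrow> ('v, 'k) talg \<Rightarrow> _" by (rule vector_space_fscale)
  note bs = bilinear_shuffle and bb = bilinear_f_bullet[OF f]
  have cs: "\<forall>a\<in>T. \<forall>b\<in>T. shuffle sV a b \<in> T" and cb: "\<forall>a\<in>T. \<forall>b\<in>T. f_bullet sV f a b \<in> T"
    using shuffle_closed f_bullet_closed[OF f] by blast+
  note tri = trilinear_compose
  note te = trilinear_eq_on_tensor_algebra[OF _ _ vector_space_fscale]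
  note sums = bilinear_word_sum[OF vector_space_fscale bs word_in_tensor_algebra[OF sV]]
    bilinear_word_sum[OF vector_space_fscale bb word_in_tensor_algebra[OF sV]]
    shuffle_word[OF sV] f_bullet_word_sum_list[OF f]
  show ?thesis
  proof unfold_locales
    show "subspace T" by (rule subspace_tensor_algebra[OF sV])
    fix a b c :: "('v, 'k) talg"
    assume a: "a \<in> T" and b: "b \<in> T"
    show "shuffle sV a b \<in> T" "f_bullet sV f a b \<in> T" using a b cs cb by blast+
    show "shuffle sV a b = shuffle sV b a" using a b by (rule shuffle_commute)
    assume c: "c \<in> T"
    show "shuffle sV (shuffle sV a b) c = shuffle sV a (shuffle sV b c)"
      by (rule te[OF tri(1)[OF bs bs cs] tri(2)[OF bs bs cs] _ a b c])
        (simp add: sums sum_shuffle_list_assoc)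
    show "f_bullet sV f (shuffle sV a b) c =
      shuffle sV (f_bullet sV f a c) b + shuffle sV a (f_bullet sV f b c)"
      by (rule te[OF tri(1)[OF bb bs cs]
            trilinear_add[OF vector_space_fscale tri(3)[OF bs bb cb] tri(2)[OF bs bb cb]] _ a b c])
        (simp add: sums sum_bullet_list_derivation)
    \<comment> \<open>The form without subtraction is the one proved for words; the differences are
      restored afterwards.\<close>
    have "f_bullet sV f (f_bullet sV f a b) c + f_bullet sV f a (f_bullet sV f c b) =
      f_bullet sV f (f_bullet sV f a c) b + f_bullet sV f a (f_bullet sV f b c)"
      by (rule te[OF trilinear_add[OF vector_space_fscale tri(1)[OF bb bb cb] tri(4)[OF bb bb cb]]
            trilinear_add[OF vector_space_fscale tri(3)[OF bb bb cb] tri(2)[OF bb bb cb]] _ a b c])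
        (simp only: sums sum_bullet_list_prelie)
    thus "f_bullet sV f (f_bullet sV f a b) c - f_bullet sV f a (f_bullet sV f b c) =
      f_bullet sV f (f_bullet sV f a c) b - f_bullet sV f a (f_bullet sV f c b)"
      by (simp only: diff_eq_eq diff_add_eq eq_diff_eq)
  qed (rule bs bb)+
qed

section \<open>The coproduct and its Sweedler sums\<close>

lemma deconc_word_splits: "deconc sV (W w) = (\<Sum>(p, q)\<leftarrow>splits w. tens fscale T (W p) (W q))"
  unfolding deconc_word[OF sV] sum_splits_eq_sum_take_drop ..

lemma linear_deconc: "Vector_Spaces.linear fscale fscale (deconc sV)"
proof -
  note t = linear_on_tens[OF vector_space_fscale subspace_tensor_algebra[OF sV]
      word_in_tensor_algebra[OF sV]]
  have m: "W (us @ (x + y) # vs) = W (us @ x # vs) + W (us @ y # vs)"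
    "W (us @ sV c x # vs) = fscale c (W (us @ x # vs))" for us vs x y c
    using multilinear_word[OF sV]
    unfolding multilinear_def linear_iff_all[OF sV vector_space_fscale] by auto
  have "multilinear sV fscale (\<lambda>w. \<Sum>(p, q)\<leftarrow>splits w. tens fscale T (W p) (W q))"
    by (rule multilinear_splits[OF vector_space_fscale])
      (use t in \<open>simp_all add: multilinear_def linear_iff_all[OF sV vector_space_fscale] m linear_on_def
        word_in_tensor_algebra[OF sV]\<close>)
  from word_lift(1)[OF sV vector_space_fscale this] show ?thesis
    by (simp add: deconc_def sum_splits_eq_sum_take_drop)
qed

lemma deconc_closed: "a \<in> T \<Longrightarrow> deconc sV a \<in> tensor_square fscale T"
proof (rule image_in_subspace[OF linear_imp_linear_on[OF linear_deconc] vector_space_fscale])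
  interpret f: vector_space "fscale :: 'k \<Rightarrow> (('v, 'k) talg, 'k) tensor2 \<Rightarrow> _"
    by (rule vector_space_fscale)
  show sub: "f.subspace (tensor_square fscale T)"
    unfolding tensor_square_def by (rule f.subspace_span)
  show "deconc sV (W w) \<in> tensor_square fscale T" for w
    unfolding deconc_word_splits case_prod_unfold
    by (rule sum_list_in_subspace[OF vector_space_fscale sub])
      (unfold tensor_square_def, rule f.span_base, use word_in_tensor_algebra[OF sV] in blast)
qed

lemma sweedler_deconc_word:
  assumes "vector_space s" "bilinear_on fscale s T g"
  shows "sweedler fscale T s (deconc sV (W w)) g = (\<Sum>(p, q)\<leftarrow>splits w. g (W p) (W q))"
  unfolding deconc_word_splits
  by (simp add: linear_sum_list_image[OF linear_sweedler[OF assms]] case_prod_unfold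
      sweedler_tens[OF assms] word_in_tensor_algebra[OF sV])

lemma linear_sweedler_deconc:
  assumes "vector_space s" "bilinear_on fscale s T g"
  shows "linear_on fscale s T (\<lambda>t. sweedler fscale T s (deconc sV t) g)"
  using Vector_Spaces.linear_compose[OF linear_deconc linear_sweedler[OF assms]]
  by (auto simp: o_def intro: linear_imp_linear_on)

text \<open>Linear dependence on a parameter of the integrand is not formal, because
  \<open>sweedler\<close> chooses a lift for each integrand. It is checked for words
  \<open>t\<close>, where the value is an explicit sum, and then extended in
  \<open>t\<close>.\<close>

lemma linear_sweedler_parameter:
  assumes s: "vector_space s" and b: "\<And>x. x \<in> T \<Longrightarrow> bilinear_on fscale s T (g x)"
    and l: "\<And>p q. \<lbrakk>p \<in> T; q \<in> T\<rbrakk> \<Longrightarrow> linear_on fscale s T (\<lambda>x. g x p q)"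
    and t: "t \<in> T"
  shows "linear_on fscale s T (\<lambda>x. sweedler fscale T s (deconc sV t) (g x))"
proof -
  interpret s: vector_space s by fact
  interpret f: vector_space fscale by (rule vector_space_fscale)
  note sub = subspace_tensor_algebra[OF sV] and w = word_in_tensor_algebra[OF sV]
  note sl = linear_sweedler_deconc[OF s b, unfolded linear_on_def]
  have gw: "g (x + y) (W p) (W q) = g x (W p) (W q) + g y (W p) (W q)"
    "g (fscale c x) (W p) (W q) = s c (g x (W p) (W q))" if "x \<in> T" "y \<in> T" for x y c p q
    using l[OF w w, of p q] that by (simp_all add: linear_on_def)
  have scale: "(\<Sum>x\<leftarrow>xs. s c (F x)) = s c (\<Sum>x\<leftarrow>xs. F x)" for xs c and F :: "'e \<Rightarrow> _"
    by (induction xs) (simp_all add: s.scale_right_distrib)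
  let ?S = "\<lambda>t x. sweedler fscale T s (deconc sV t) (g x)"
  have "?S t (x + y) = ?S t x + ?S t y" if x: "x \<in> T" and y: "y \<in> T" for x y
  proof (rule eq_on_tensor_algebra[OF _ _ s _ t])
    show "linear_on fscale s T (\<lambda>t. ?S t (x + y))"
      using x y by (intro linear_sweedler_deconc[OF s b] f.subspace_add[OF sub])
    show "linear_on fscale s T (\<lambda>t. ?S t x + ?S t y)"
      using sl[OF x] sl[OF y] by (simp add: linear_on_def s.scale_right_distrib)
    show "?S (W w) (x + y) = ?S (W w) x + ?S (W w) y" for w
      using x y
      by (simp add: sweedler_deconc_word[OF s b] f.subspace_add[OF sub] gw sum_list_case_prod_add del: plus_fun_apply)
  qed
  moreover have "?S t (fscale c x) = s c (?S t x)" if x: "x \<in> T" for x c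
  proof (rule eq_on_tensor_algebra[OF _ _ s _ t])
    show "linear_on fscale s T (\<lambda>t. ?S t (fscale c x))"
      using x by (intro linear_sweedler_deconc[OF s b] f.subspace_scale[OF sub])
    show "linear_on fscale s T (\<lambda>t. s c (?S t x))"
      using sl[OF x] by (simp add: linear_on_def s.scale_right_distrib mult.commute)
    show "?S (W w) (fscale c x) = s c (?S (W w) x)" for w
      using x
      by (simp add: sweedler_deconc_word[OF s b] f.subspace_scale[OF sub] gw[OF x x] case_prod_unfold scale)
  qed
  ultimately show ?thesis by (simp add: linear_on_def)
qed

text \<open>Before the outer sum can be evaluated, the inner one must be bilinear in
  \<open>a1\<close> and \<open>a2\<close>; these are parameters of its integrand, so
  \<open>linear_sweedler_parameter\<close> applies.\<close>

lemma sweedler_sweedler: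
  assumes s: "vector_space s"
    and l: "\<And>p q. \<lbrakk>p \<in> T; q \<in> T\<rbrakk> \<Longrightarrow> bilinear_on fscale s T (g p q)"
    and r: "\<And>p q. \<lbrakk>p \<in> T; q \<in> T\<rbrakk> \<Longrightarrow> bilinear_on fscale s T (\<lambda>a1 a2. g a1 a2 p q)"
  defines "S \<equiv> \<lambda>a b. sweedler fscale T s (deconc sV a)
    (\<lambda>a1 a2. sweedler fscale T s (deconc sV b) (\<lambda>b1 b2. g a1 a2 b1 b2))"
  shows "bilinear_on fscale s T S"
    and "S (W u) (W v) = (\<Sum>(u1, u2)\<leftarrow>splits u. \<Sum>(v1, v2)\<leftarrow>splits v. g (W u1) (W u2) (W v1) (W v2))"
proof -
  note w = word_in_tensor_algebra[OF sV]
  have i: "bilinear_on fscale s T (\<lambda>a1 a2. sweedler fscale T s (deconc sV b) (g a1 a2))"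
    if b: "b \<in> T" for b
    unfolding bilinear_on_def
    using b r by (intro conjI ballI linear_sweedler_parameter[OF s] l) (simp_all add: bilinear_on_def)
  have 1: "linear_on fscale s T (\<lambda>a. S a b)" if "b \<in> T" for b
    unfolding S_def using that by (intro linear_sweedler_deconc[OF s] i)
  have 2: "linear_on fscale s T (S a)" if a: "a \<in> T" for a
    unfolding S_def
    using a by (intro linear_sweedler_parameter[OF s] i linear_sweedler_deconc[OF s] l)
  show "bilinear_on fscale s T S" using 1 2 by (simp add: bilinear_on_def)
  show "S (W u) (W v) = (\<Sum>(u1, u2)\<leftarrow>splits u. \<Sum>(v1, v2)\<leftarrow>splits v. g (W u1) (W u2) (W v1) (W v2))"
    unfolding S_def by (simp add: sweedler_deconc_word[OF s i] sweedler_deconc_word[OF s l] w)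
qed

section \<open>The counit and the bialgebra axioms\<close>

definition counit :: "('v, 'k) talg \<Rightarrow> 'k" where
  "counit = word_lift sV (*) (\<lambda>w. if w = [] then 1 else 0)"

lemma counit:
  shows "Vector_Spaces.linear fscale (*) counit"
    and "counit (W w) = (if w = [] then 1 else 0)"
proof -
  interpret vector_space_pair sV "(*) :: 'k \<Rightarrow> _"
    using sV vector_space_mult by (simp add: vector_space_pair_def)
  have "multilinear sV (*) (\<lambda>w. if w = [] then 1 else (0 :: 'k))"
    by (simp add: multilinear_def linear_zero)
  from word_lift[OF sV vector_space_mult this] show "Vector_Spaces.linear fscale (*) counit"
    and "counit (W w) = (if w = [] then 1 else 0)"
    unfolding counit_def by auto
qed

lemma bialgebra_shuffle_deconc:
  "bialgebra fscale T (shuffle sV) (W []) (deconc sV) counit"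
proof -
  interpret vector_space "fscale :: 'k \<Rightarrow> ('v, 'k) talg \<Rightarrow> _" by (rule vector_space_fscale)
  note sub = subspace_tensor_algebra[OF sV] and w = word_in_tensor_algebra[OF sV]
  note bs = bilinear_shuffle
  note ext = eq_on_tensor_algebra[OF _ _ vector_space_fscale]
  note lin = linear_sweedler_deconc[OF vector_space_fscale]
  note val = sweedler_deconc_word[OF vector_space_fscale]
  note c = counit(1)[unfolded linear_iff_all[OF vector_space_fscale vector_space_mult]]
  have cs: "\<forall>a\<in>T. \<forall>b\<in>T. shuffle sV a b \<in> T" using shuffle_closed by blast
  \<comment> \<open>Associativity is read off from the Com-PreLie algebra of the identity
    endomorphism.\<close>
  have assoc: "shuffle sV (shuffle sV a b) c = shuffle sV a (shuffle sV b c)"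
    and comm: "shuffle sV a b = shuffle sV b a"
    if "a \<in> T" "b \<in> T" "c \<in> T" for a b c
    using com_prelie_algebra.mul_assoc[OF com_prelie_f_bullet[OF Vector_Spaces.vector_space.linear_id[OF sV]] that]
      shuffle_commute[OF that(1,2)] by auto
  show ?thesis
  proof unfold_locales
    show "subspace T" by (rule sub)
    show "bilinear_on fscale fscale T (shuffle sV)" by (rule bs)
    show "W [] \<in> T" by (rule w)
    show "linear_on fscale fscale T (deconc sV)" by (rule linear_imp_linear_on[OF linear_deconc])
    show "linear_on fscale (*) T counit" by (rule linear_imp_linear_on[OF counit(1)])
    show "deconc sV (W []) = tens fscale T (W []) (W [])" by (simp add: deconc_word_splits)
    show "counit (W []) = 1" by (simp add: counit(2))
    fix a b :: "('v, 'k) talg"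
    assume a: "a \<in> T"
    show "shuffle sV (W []) a = a" using a by (rule shuffle_unit)
    thus "shuffle sV a (W []) = a" using comm[OF a w w] by simp
    show "deconc sV a \<in> tensor_square fscale T" using a by (rule deconc_closed)
    have l: "bilinear_on fscale fscale T (\<lambda>a1 a2. fscale (counit a1) a2)"
      and r: "bilinear_on fscale fscale T (\<lambda>a1 a2. fscale (counit a2) a1)"
      by (rule bilinear_onI; simp add: c scale_right_distrib scale_left_distrib mult.commute del: plus_fun_apply)+
    \<comment> \<open>The prefix \<open>y\<close> accumulates the letters already passed, as the
      induction on \<open>x\<close> removes letters on the left while the surviving cut is at the
      right end.\<close>
    have r1: "(\<Sum>(p, q)\<leftarrow>splits x. fscale (counit (W q)) (W (y @ p))) = W (y @ x)" for x y
    proof (induction x arbitrary: y)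
      case (Cons a x)
      show ?case
        using Cons[of "y @ [a]"] by (simp add: counit(2) sum_splits_Cons del: splits.simps(2))
    qed (simp add: counit(2))
    show "sweedler fscale T fscale (deconc sV a) (\<lambda>a1 a2. fscale (counit a1) a2) = a"
      by (rule ext[where G = "\<lambda>a. a", OF lin[OF l] _ _ a])
        (simp_all add: linear_on_def val[OF l] sum_splits_eq_first counit(2))
    show "sweedler fscale T fscale (deconc sV a) (\<lambda>a1 a2. fscale (counit a2) a1) = a"
      by (rule ext[where G = "\<lambda>a. a", OF lin[OF r] _ _ a])
        (use r1[where y = "[]"] in \<open>simp_all add: linear_on_def val[OF r]\<close>)
    have t3: "bilinear_on fscale fscale T (\<lambda>b c. tens3 fscale T b c x)"
      "bilinear_on fscale fscale T (\<lambda>b c. tens3 fscale T x b c)"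
      "linear_on fscale fscale T (\<lambda>b. tens3 fscale T x y b)"
      "linear_on fscale fscale T (\<lambda>b. tens3 fscale T b x y)"
      if "x \<in> T" "y \<in> T" for x y
      using trilinear_tens3[OF vector_space_fscale sub] that
      by (simp_all add: trilinear_on_def bilinear_on_def)
    have cl: "bilinear_on fscale fscale T
      (\<lambda>a1 a2. sweedler fscale T fscale (deconc sV a1) (\<lambda>b c. tens3 fscale T b c a2))"
      unfolding bilinear_on_def
      by (intro conjI ballI lin linear_sweedler_parameter[OF vector_space_fscale] t3)
    have cr: "bilinear_on fscale fscale T
      (\<lambda>a1 a2. sweedler fscale T fscale (deconc sV a2) (\<lambda>b c. tens3 fscale T a1 b c))"
      unfolding bilinear_on_def
      by (intro conjI ballI lin linear_sweedler_parameter[OF vector_space_fscale] t3)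
    show "sweedler fscale T fscale (deconc sV a)
        (\<lambda>a1 a2. sweedler fscale T fscale (deconc sV a1) (\<lambda>b c. tens3 fscale T b c a2)) =
      sweedler fscale T fscale (deconc sV a)
        (\<lambda>a1 a2. sweedler fscale T fscale (deconc sV a2) (\<lambda>b c. tens3 fscale T a1 b c))"
      by (rule ext[OF lin[OF cl] lin[OF cr] _ a])
        (simp add: val[OF cl] val[OF cr] val[OF t3(1)[OF w w]] val[OF t3(2)[OF w w]] sum_splits_coassoc)
    assume b: "b \<in> T"
    show "shuffle sV a b \<in> T" using cs a b by blast
    have q: "bilinear_on fscale fscale T (\<lambda>b1 b2. tens fscale T (shuffle sV x b1) (shuffle sV y b2))"
      "bilinear_on fscale fscale T (\<lambda>a1 a2. tens fscale T (shuffle sV a1 x) (shuffle sV a2 y))"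
      if "x \<in> T" "y \<in> T" for x y
      using quadrilinear_tens[OF vector_space_fscale sub bs cs bs cs that] by auto
    note t1 = linear_on_tens[OF vector_space_fscale sub]
    have "linear_on fscale fscale T (\<lambda>a. deconc sV (shuffle sV a b))"
      "linear_on fscale fscale T (\<lambda>a. deconc sV (shuffle sV b a))" if "b \<in> T" for b
      using linear_deconc bs that
      by (simp_all add: linear_on_def bilinear_on_def linear_iff_all[OF vector_space_fscale vector_space_fscale])
    hence bd: "bilinear_on fscale fscale T (\<lambda>a b. deconc sV (shuffle sV a b))"
      by (simp add: bilinear_on_def)
    have bt: "bilinear_on fscale fscale T (tens fscale T)" using t1 by (simp add: bilinear_on_def)
    show "deconc sV (shuffle sV a b) = sweedler fscale T fscale (deconc sV a) (\<lambda>a1 a2.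
      sweedler fscale T fscale (deconc sV b) (\<lambda>b1 b2. tens fscale T (shuffle sV a1 b1) (shuffle sV a2 b2)))"
    proof (rule bilinear_eq_on_tensor_algebra[OF bd
          sweedler_sweedler(1)[OF vector_space_fscale q] vector_space_fscale _ a b])
      fix u v
      \<comment> \<open>Both tensor factors are expanded into words to reach the form of
        \<open>sum_splits_shuffle_list\<close>.\<close>
      have "tens fscale T (shuffle sV (W u1) (W v1)) (shuffle sV (W u2) (W v2)) =
        (\<Sum>p\<leftarrow>shuffle_list u1 v1. \<Sum>q\<leftarrow>shuffle_list u2 v2. tens fscale T (W p) (W q))"
        for u1 u2 v1 v2
        by (simp add: shuffle_word[OF sV] bilinear_word_sum[OF vector_space_fscale bt]
            word_sum_in_tensor_algebra w) (rule sum_list_swap)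
      thus "deconc sV (shuffle sV (W u) (W v)) =
        sweedler fscale T fscale (deconc sV (W u)) (\<lambda>a1 a2. sweedler fscale T fscale (deconc sV (W v))
          (\<lambda>b1 b2. tens fscale T (shuffle sV a1 b1) (shuffle sV a2 b2)))"
        by (simp only: sweedler_sweedler(2)[OF vector_space_fscale q])
          (simp add: shuffle_word[OF sV] linear_sum_list_image[OF linear_deconc] deconc_word_splits sum_splits_shuffle_list)
    qed
    have "linear_on fscale (*) T (\<lambda>a. counit (shuffle sV a b))"
      "linear_on fscale (*) T (\<lambda>a. counit (shuffle sV b a))" if "b \<in> T" for b
      using c bs that by (simp_all add: linear_on_def bilinear_on_def)
    hence bc: "bilinear_on fscale (*) T (\<lambda>a b. counit (shuffle sV a b))"
      by (simp add: bilinear_on_def)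
    show "counit (shuffle sV a b) = counit a * counit b"
    proof (rule bilinear_eq_on_tensor_algebra[OF bc _ vector_space_mult _ a b])
      show "bilinear_on fscale (*) T (\<lambda>a b. counit a * counit b)"
        by (rule bilinear_onI) (simp_all add: c algebra_simps)
      show "counit (shuffle sV (W u) (W v)) = counit (W u) * counit (W v)" for u v
        unfolding shuffle_word[OF sV] linear_sum_list_image[OF counit(1)] counit(2)
        \<comment> \<open>A shuffle of two words is empty only if both words are.\<close>
        by (cases u; cases v) (simp_all add: o_def)
    qed
    fix c assume "c \<in> T"
    thus "shuffle sV (shuffle sV a b) c = shuffle sV a (shuffle sV b c)" using assoc a b by blast
  qed
qed

section \<open>Compatibility of the product of T(V,f) with deconcatenation\<close>

lemma com_prelie_bialgebra_f_bullet:
  assumes f: "Vector_Spaces.linear sV sV f"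
  shows "com_prelie_bialgebra fscale T (shuffle sV) (f_bullet sV f) (deconc sV)"
proof -
  let ?B = "f_bullet sV f"
  note sub = subspace_tensor_algebra[OF sV] and w = word_in_tensor_algebra[OF sV]
  note bs = bilinear_shuffle and bb = bilinear_f_bullet[OF f]
  note t1 = linear_on_tens[OF vector_space_fscale sub]
  note words = shuffle_word[OF sV] f_bullet_word_sum_list[OF f]
  have cs: "\<forall>a\<in>T. \<forall>b\<in>T. shuffle sV a b \<in> T" and cb: "\<forall>a\<in>T. \<forall>b\<in>T. ?B a b \<in> T"
    using shuffle_closed f_bullet_closed[OF f] by blast+
  have q: "bilinear_on fscale fscale T (\<lambda>b1 b2. tens fscale T (?B x b1) (shuffle sV y b2))"
    "bilinear_on fscale fscale T (\<lambda>a1 a2. tens fscale T (?B a1 x) (shuffle sV a2 y))"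
    if "x \<in> T" "y \<in> T" for x y
    using quadrilinear_tens[OF vector_space_fscale sub bb cb bs cs that] by auto
  have bt: "bilinear_on fscale fscale T (tens fscale T)" using t1 by (simp add: bilinear_on_def)
  have d: "bilinear_on fscale fscale T (\<lambda>a1 a2. tens fscale T a1 (?B a2 b))" if "b \<in> T" for b
    using bb bt cb that by (simp add: bilinear_on_def linear_on_def)
  \<comment> \<open>In the first Sweedler sum \<open>b\<close> is a parameter of the integrand; this
    gives linearity of \<open>?S1\<close> in \<open>b\<close>.\<close>
  have d': "linear_on fscale fscale T (\<lambda>b. tens fscale T a1 (?B a2 b))" if "a1 \<in> T" "a2 \<in> T" for a1 a2
    using bb bt cb that by (simp add: bilinear_on_def linear_on_def)
  have "deconc sV (?B a b) =
      sweedler fscale T fscale (deconc sV a) (\<lambda>a1 a2. tens fscale T a1 (?B a2 b)) +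
      sweedler fscale T fscale (deconc sV a) (\<lambda>a1 a2. sweedler fscale T fscale (deconc sV b)
        (\<lambda>b1 b2. tens fscale T (?B a1 b1) (shuffle sV a2 b2)))" (is "_ = ?S1 a b + ?S2 a b")
    if a: "a \<in> T" and b: "b \<in> T" for a b
  proof (rule bilinear_eq_on_tensor_algebra[where F = "\<lambda>a b. deconc sV (?B a b)"
        and G = "\<lambda>a b. ?S1 a b + ?S2 a b", OF _ _ vector_space_fscale _ a b])
    show "bilinear_on fscale fscale T (\<lambda>a b. deconc sV (?B a b))"
      using linear_deconc bb
      by (simp add: linear_on_def bilinear_on_def linear_iff_all[OF vector_space_fscale vector_space_fscale])
    have "bilinear_on fscale fscale T ?S1"
      unfolding bilinear_on_def
      by (intro conjI ballI linear_sweedler_deconc[OF vector_space_fscale]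
          linear_sweedler_parameter[OF vector_space_fscale] d d')
    moreover have "bilinear_on fscale fscale T ?S2"
      by (rule sweedler_sweedler(1)[OF vector_space_fscale q])
    ultimately show "bilinear_on fscale fscale T (\<lambda>a b. ?S1 a b + ?S2 a b)"
      by (simp add: bilinear_on_def linear_on_def ac_simps
          module.scale_right_distrib[OF module_fscale] del: plus_fun_apply)
    fix u v
    have "tens fscale T (?B (W u1) (W v1)) (shuffle sV (W u2) (W v2)) =
        (\<Sum>p\<leftarrow>bullet_list f u1 v1. \<Sum>q\<leftarrow>shuffle_list u2 v2. tens fscale T (W p) (W q))"
      for u1 u2 v1 v2
      by (simp add: words bilinear_word_sum[OF vector_space_fscale bt]
          word_sum_in_tensor_algebra w) (rule sum_list_swap)
    moreover have "tens fscale T (W u1) (?B (W u2) (W v)) =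
        (\<Sum>q\<leftarrow>bullet_list f u2 v. tens fscale T (W u1) (W q))" for u1 u2
      by (simp add: words bilinear_word_sum[OF vector_space_fscale bt]
          word_sum_in_tensor_algebra w)
    ultimately show "deconc sV (?B (W u) (W v)) = ?S1 (W u) (W v) + ?S2 (W u) (W v)"
      by (simp only: sweedler_sweedler(2)[OF vector_space_fscale q]
          sweedler_deconc_word[OF vector_space_fscale d] w)
        (simp add: words linear_sum_list_image[OF linear_deconc] deconc_word_splits
          sum_splits_bullet_list del: plus_fun_apply)
  qed
  thus ?thesis
    unfolding com_prelie_bialgebra_def
    using com_prelie_f_bullet[OF f] bialgebra_shuffle_deconc by blast
qed

subsection \<open>Homogeneous products\<close>

text \<open>The projection \<pi> onto degree one, followed by the identification of that degree with
  V.\<close>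

definition letter :: "('v, 'k) talg \<Rightarrow> 'v" where
  "letter = word_lift sV sV (\<lambda>w. if length w = 1 then hd w else 0)"

text \<open>Concatenation after \<pi> \<otimes> id, written as a bilinear map so that it can be the
  integrand of a Sweedler sum.\<close>

definition attach :: "('v, 'k) talg \<Rightarrow> ('v, 'k) talg \<Rightarrow> ('v, 'k) talg" where
  "attach s t = word_lift sV fscale (\<lambda>u. word_lift sV fscale
     (\<lambda>v. if length u = 1 then W (hd u # v) else 0) t) s"

lemma letter:
  shows "Vector_Spaces.linear fscale sV letter"
    and "letter (W w) = (if length w = 1 then hd w else 0)"
proof -
  interpret vector_space_pair sV sV using sV by (simp add: vector_space_pair_def)
  have "Vector_Spaces.linear sV sV (\<lambda>x. if length (us @ x # vs) = 1 then hd (us @ x # vs) else 0)"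
    for us vs
    \<comment> \<open>With no further letters the map is the identity; otherwise the word has length
      at least two and the map is zero.\<close>
    by (cases us; cases vs) (simp_all add: linear_zero vs1.linear_ident)
  hence "multilinear sV sV (\<lambda>w. if length w = 1 then hd w else 0)"
    by (simp add: multilinear_def)
  from word_lift[OF sV sV this] show "Vector_Spaces.linear fscale sV letter"
    and "letter (W w) = (if length w = 1 then hd w else 0)"
    unfolding letter_def by auto
qed

lemma letter_tensor_power:
  assumes "t \<in> tensor_power sV n" "n \<noteq> 1"
  shows "letter t = 0"
proof -
  interpret vector_space_pair fscale sV
    using sV vector_space_fscale by (simp add: vector_space_pair_def)
  show ?thesis
    by (rule lift_unique[OF letter(1) linear_zero, where X = "{w :: 'v list. length w = n}" and e = W])
      (use assms in \<open>simp_all add: letter(2) tensor_power_def\<close>)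
qed

lemma attach:
  shows "bilinear_on fscale fscale T attach"
    and "attach (W u) (W v) = (if length u = 1 then W (hd u # v) else 0)"
proof -
  interpret vector_space_pair sV "fscale :: 'k \<Rightarrow> ('v, 'k) talg \<Rightarrow> _"
    using sV vector_space_fscale by (simp add: vector_space_pair_def)
  have "Vector_Spaces.linear sV fscale
    (\<lambda>x. if length (us @ x # vs) = 1 then W (hd (us @ x # vs) # v) else 0)" for us vs v
    using multilinear_word[OF sV, unfolded multilinear_def, rule_format, of "[]" v]
    by (cases us; cases vs) (simp_all add: linear_zero)
  hence l: "multilinear sV fscale (\<lambda>u. if length u = 1 then W (hd u # v) else 0)" for v
    by (simp add: multilinear_def)
  have r: "multilinear sV fscale (\<lambda>v. if length u = 1 then W (hd u # v) else 0)" for u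
    using multilinear_Cons[OF sV multilinear_word[OF sV], of "hd u"]
    by (cases "length u = 1") (simp_all add: multilinear_def linear_zero)
  note b = bilinear_word_lift[OF vector_space_fscale l r]
  show "bilinear_on fscale fscale T attach"
    unfolding attach_def[abs_def] by (rule b(1))
  show "attach (W u) (W v) = (if length u = 1 then W (hd u # v) else 0)"
    unfolding attach_def by (rule b(2))
qed

text \<open>If \<open>t\<close> is a word that is not a letter, both sides vanish, since a word
  containing the letter 0 is zero.\<close>

lemma attach_word:
  assumes t: "t \<in> T"
  shows "attach t (W v) = W (letter t # v)"
proof (rule eq_on_tensor_algebra[OF _ _ vector_space_fscale _ t])
  have m: "Vector_Spaces.linear sV fscale (\<lambda>x. W (x # v))"
    using multilinear_word[OF sV, unfolded multilinear_def, rule_format, of "[]" v] by simp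
  interpret m: Vector_Spaces.linear sV fscale "\<lambda>x. W (x # v)" by (rule m)
  show "linear_on fscale fscale T (\<lambda>t. attach t (W v))"
    using attach(1) word_in_tensor_algebra[OF sV] by (simp add: bilinear_on_def)
  show "linear_on fscale fscale T (\<lambda>t. W (letter t # v))"
    using Vector_Spaces.linear_compose[OF letter(1) m]
    by (auto simp: o_def intro: linear_imp_linear_on)
  show "attach (W w) (W v) = W (letter (W w) # v)" for w
    by (simp add: attach(2) letter(2) m.zero)
qed

lemma word_attach_eq_0:
  assumes t: "t \<in> T" and u: "length u \<noteq> 1"
  shows "attach (W u) t = 0"
  by (rule eq_on_tensor_algebra[where F = "attach (W u)" and G = "\<lambda>_. 0",
        OF _ _ vector_space_fscale _ t])
    (use attach word_in_tensor_algebra[OF sV] u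
      in \<open>simp_all add: bilinear_on_def linear_on_def module.scale_zero_right[OF module_fscale]\<close>)

text \<open>Only the cut after the first letter survives, and concatenation undoes it. Degree 0 is
  excluded because \<emptyset> is sent to 0.\<close>

lemma attach_deconc:
  assumes t: "t \<in> tensor_power sV n" and n: "n \<noteq> 0"
  shows "sweedler fscale T fscale (deconc sV t) attach = t"
proof -
  let ?R = "\<lambda>t. sweedler fscale T fscale (deconc sV t) attach"
  interpret vector_space "fscale :: 'k \<Rightarrow> ('v, 'k) talg \<Rightarrow> _" by (rule vector_space_fscale)
  have l: "Vector_Spaces.linear fscale fscale ?R"
    using Vector_Spaces.linear_compose[OF linear_deconc
        linear_sweedler[OF vector_space_fscale attach(1)]] by (simp add: o_def)
  show ?thesis
  proof (rule lift_unique[OF l linear_ident, where X = "{w :: 'v list. length w = n}" and e = W])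
    show "t \<in> span (W ` {w. length w = n})" using t by (simp add: tensor_power_def)
    fix w :: "'v list" assume "w \<in> {w. length w = n}"
    then obtain x u where w: "w = x # u" using n by (cases w) auto
    show "?R (W w) = W w"
      unfolding w
      by (simp add: sweedler_deconc_word[OF vector_space_fscale attach(1)] sum_splits_Cons
          attach(2) sum_splits_eq_first del: splits.simps(2))
  qed
qed

section \<open>A homogeneous product on words\<close>

text \<open>All degrees \<open>N\<close> are treated at once: for \<open>N\<close> > 0 the map
  \<open>f\<close> is zero for degree reasons, and the formula then gives the zero product.\<close>

lemma homogeneous_bullet_word:
  assumes cp: "com_prelie_bialgebra fscale T (shuffle sV) bul (deconc sV)"
    and hom: "\<And>k l s t. \<lbrakk>s \<in> tensor_power sV k; t \<in> tensor_power sV l\<rbrakk>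
      \<Longrightarrow> bul s t \<in> tensor_power sV (k + l + N)"
  defines "f \<equiv> \<lambda>x. letter (bul (W [x]) (W []))"
  shows "bul (W u) (W v) = (\<Sum>w\<leftarrow>bullet_list f u v. W w)"
proof -
  interpret com_prelie_algebra fscale T "shuffle sV" bul
    using cp by (simp add: com_prelie_bialgebra_def)
  note sub = subspace_tensor_algebra[OF sV] and w = word_in_tensor_algebra[OF sV]
  note bs = mul_bilinear and bb = bul_bilinear
  have cs: "\<forall>a\<in>T. \<forall>b\<in>T. shuffle sV a b \<in> T" and cb: "\<forall>a\<in>T. \<forall>b\<in>T. bul a b \<in> T"
    using mul_closed bul_closed by blast+
  have pow: "W u \<in> tensor_power sV (length u)" for u
    unfolding tensor_power_def by (rule span_base) simp
  have unit_bul: "bul (W []) b = 0" if b: "b \<in> T" for b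
  proof -
    have c: "bul (W []) b \<in> T" using bul_closed[OF w b] .
    \<comment> \<open>This is the derivation rule for \<emptyset> = \<emptyset> \<squnion>
      \<emptyset>.\<close>
    have "bul (W []) b = bul (W []) b + bul (W []) b"
      using derivation[OF w w b, of "[]" "[]"] shuffle_unit[OF w] shuffle_unit[OF c]
        shuffle_commute[OF c w] by simp
    thus ?thesis by (simp only: add_cancel_right_left)
  qed
  \<comment> \<open>If \<open>p\<close> is nonempty, the total length is at least 2, so the product
    has degree at least 2 for every \<open>N\<close>. The case left open is a letter
    \<open>p\<close> with empty \<open>r\<close>, which defines \<open>f\<close>.\<close>
  have letter0: "letter (bul (W p) (W r)) = 0" if "p = [] \<or> length p + length r \<noteq> 1" for p r
  proof (cases "p = []")
    case True
    interpret l: Vector_Spaces.linear fscale sV letter by (rule letter(1))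
    show ?thesis using True unit_bul[OF w] l.zero by simp
  next
    case False
    with that have "length p + length r + N \<noteq> 1" by (cases p) auto
    thus ?thesis using letter_tensor_power[OF hom[OF pow pow]] by blast
  qed
  have bt: "bilinear_on fscale fscale T (tens fscale T)"
    using linear_on_tens[OF vector_space_fscale sub] by (simp add: bilinear_on_def)
  have d: "bilinear_on fscale fscale T (\<lambda>a1 a2. tens fscale T a1 (bul a2 b))" if "b \<in> T" for b
    using bb bt cb that by (simp add: bilinear_on_def linear_on_def)
  have q: "bilinear_on fscale fscale T (\<lambda>b1 b2. tens fscale T (bul x b1) (shuffle sV y b2))"
    "bilinear_on fscale fscale T (\<lambda>a1 a2. tens fscale T (bul a1 x) (shuffle sV a2 y))"
    if "x \<in> T" "y \<in> T" for x y
    using quadrilinear_tens[OF vector_space_fscale sub bb cb bs cs that] by auto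
  have deconc: "deconc sV (bul (W u) (W v)) =
      (\<Sum>(p, q)\<leftarrow>splits u. tens fscale T (W p) (bul (W q) (W v))) +
      (\<Sum>(p, q)\<leftarrow>splits u. \<Sum>(r, s)\<leftarrow>splits v.
        tens fscale T (bul (W p) (W r)) (shuffle sV (W q) (W s)))" for u v
    using cp w sweedler_sweedler(2)[OF vector_space_fscale q]
    by (simp add: com_prelie_bialgebra_def sweedler_deconc_word[OF vector_space_fscale d])
  let ?L = "\<lambda>t. sweedler fscale T fscale t attach"
  interpret L: Vector_Spaces.linear fscale fscale ?L
    by (rule linear_sweedler[OF vector_space_fscale attach(1)])
  note L_sum = linear_sum_list_image[OF L.linear_axioms]
  note L_tens = sweedler_tens[OF vector_space_fscale attach(1)]
  have step: "bul (W (x # u)) (W v) =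
    attach (W [x]) (bul (W u) (W v)) + (\<Sum>w\<leftarrow>shuffle_list u v. W (f x # w))" for x u v
  proof -
    have a: "attach (bul (W p) (W r)) (shuffle sV (W q) (W s)) =
      (\<Sum>w\<leftarrow>shuffle_list q s. W (letter (bul (W p) (W r)) # w))" for p q r s
      by (simp add: shuffle_word[OF sV] bilinear_word_sum(2)[OF vector_space_fscale attach(1)]
          bul_closed w attach_word)
    \<comment> \<open>The empty word has letter part 0, so \<open>attach_word\<close> evaluates the
      same expression in two ways.\<close>
    have z: "W (0 # v) = 0" for v
      using attach_word[OF w, of "[]" v] by (simp add: letter(2) attach(2))
    \<comment> \<open>The degree is positive because the first word is nonempty.\<close>
    have "bul (W (x # u)) (W v) = ?L (deconc sV (bul (W (x # u)) (W v)))"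
      by (rule attach_deconc[OF hom[OF pow pow], symmetric]) simp
    also have "\<dots> = (\<Sum>(p, q)\<leftarrow>splits (x # u). attach (W p) (bul (W q) (W v))) +
      (\<Sum>(p, q)\<leftarrow>splits (x # u). \<Sum>(r, s)\<leftarrow>splits v.
        \<Sum>w\<leftarrow>shuffle_list q s. W (letter (bul (W p) (W r)) # w))"
      unfolding deconc L.add
      by (simp add: L_sum case_prod_unfold L_tens w bul_closed mul_closed a
          del: plus_fun_apply splits.simps)
    \<comment> \<open>In the first sum only \<open>p = [x]\<close> survives, by
      \<open>word_attach_eq_0\<close>. In the second, \<open>letter0\<close> leaves only
      \<open>p = [x]\<close> with \<open>r = []\<close>.\<close>
    also have "\<dots> = attach (W [x]) (bul (W u) (W v)) + (\<Sum>w\<leftarrow>shuffle_list u v. W (f x # w))"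
      by (simp add: sum_splits_Cons sum_splits_eq_first word_attach_eq_0 bul_closed w letter0 z
          sum_list_case_prod_zero f_def del: splits.simps(2) plus_fun_apply)
    finally show ?thesis .
  qed
  show ?thesis
  proof (induction u)
    case Nil
    show ?case by (simp add: unit_bul w)
  next
    case (Cons x u)
    \<comment> \<open>Attaching \<open>W [x]\<close> prefixes \<open>x\<close> to every word, so
      \<open>step\<close> becomes the recursion of \<open>bullet_list\<close>.\<close>
    thus ?case
      by (simp add: step bilinear_word_sum(2)[OF vector_space_fscale attach(1)] w attach(2) o_def
          del: plus_fun_apply)
  qed
qed

section \<open>Existence and uniqueness of the endomorphism\<close>

lemma homogeneous_bullet_unique:
  assumes cp: "com_prelie_bialgebra fscale T (shuffle sV) bul (deconc sV)"
    and hom: "\<And>k l s t. \<lbrakk>s \<in> tensor_power sV k; t \<in> tensor_power sV l\<rbrakk>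
      \<Longrightarrow> bul s t \<in> tensor_power sV (k + l + N)"
  shows "\<exists>!f. Vector_Spaces.linear sV sV f \<and>
    (\<forall>s\<in>T. \<forall>t\<in>T. bul s t = f_bullet sV f s t)"
proof -
  define f where "f x = letter (bul (W [x]) (W []))" for x
  interpret com_prelie_algebra fscale T "shuffle sV" bul
    using cp by (simp add: com_prelie_bialgebra_def)
  note w = word_in_tensor_algebra[OF sV]
  have m: "W [x + y] = W [x] + W [y]" "W [sV c x] = fscale c (W [x])" for x y c
    using multilinear_word[OF sV, unfolded multilinear_def, rule_format, of "[]" "[]"]
    unfolding linear_iff_all[OF sV vector_space_fscale] by auto
  have lin: "Vector_Spaces.linear sV sV f"
    unfolding linear_iff_all[OF sV sV]
    using letter(1) by (simp add: f_def m bilinear_onD[OF bul_bilinear] w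
        linear_iff_all[OF vector_space_fscale sV] del: plus_fun_apply)
  have words: "bul (W u) (W v) = (\<Sum>w\<leftarrow>bullet_list f u v. W w)" for u v
    unfolding f_def by (rule homogeneous_bullet_word[OF cp]) (rule hom)
  have eq: "bul s t = f_bullet sV f s t" if "s \<in> T" "t \<in> T" for s t
    by (rule bilinear_eq_on_tensor_algebra[OF bul_bilinear bilinear_f_bullet[OF lin]
          vector_space_fscale _ that])
      (simp only: words f_bullet_word_sum_list[OF lin])
  \<comment> \<open>In T(V,g) the product x \<bullet> \<emptyset> is the one-letter word g(x), so
    \<open>bul\<close> determines \<open>g\<close>.\<close>
  have "g = f" if g: "Vector_Spaces.linear sV sV g" "\<forall>s\<in>T. \<forall>t\<in>T. bul s t = f_bullet sV g s t" for g
  proof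
    fix x
    have "bul (W [x]) (W []) = W [g x]"
      using g(2) w by (simp add: f_bullet_word_sum_list[OF g(1)])
    thus "g x = f x" by (simp add: f_def letter(2))
  qed
  with lin eq show ?thesis by (intro ex1I[of _ f]) blast+
qed

end

theorem proposition2p4:
  fixes sV :: "'k::field_char_0 \<Rightarrow> 'v::ab_group_add \<Rightarrow> 'v"
  assumes "vector_space sV"
  shows
    "(\<forall>f. Vector_Spaces.linear sV sV f \<longrightarrow>
        com_prelie_bialgebra fscale (tensor_algebra sV) (shuffle sV) (f_bullet sV f) (deconc sV)) \<and>
     (\<forall>bul N.
        com_prelie_bialgebra fscale (tensor_algebra sV) (shuffle sV) bul (deconc sV) \<and>
        (\<forall>k l. \<forall>s\<in>tensor_power sV k. \<forall>t\<in>tensor_power sV l. bul s t \<in> tensor_power sV (k + l + N))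
        \<longrightarrow>
        (\<exists>!f. Vector_Spaces.linear sV sV f \<and>
           (\<forall>s\<in>tensor_algebra sV. \<forall>t\<in>tensor_algebra sV. bul s t = f_bullet sV f s t)))"
proof (intro conjI allI impI)
  show "com_prelie_bialgebra fscale (tensor_algebra sV) (shuffle sV) (f_bullet sV f) (deconc sV)"
    if "Vector_Spaces.linear sV sV f" for f
    using that by (rule com_prelie_bialgebra_f_bullet[OF assms])
next
  fix bul N
  assume *: "com_prelie_bialgebra fscale (tensor_algebra sV) (shuffle sV) bul (deconc sV) \<and>
    (\<forall>k l. \<forall>s\<in>tensor_power sV k. \<forall>t\<in>tensor_power sV l. bul s t \<in> tensor_power sV (k + l + N))"
  show "\<exists>!f. Vector_Spaces.linear sV sV f \<and>
    (\<forall>s\<in>tensor_algebra sV. \<forall>t\<in>tensor_algebra sV. bul s t = f_bullet sV f s t)"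
    by (rule homogeneous_bullet_unique[OF assms, of bul N]) (use * in blast)+
qed

end
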